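(* Let $K$ be a pathwise connected poset and let $(X,\eta,J,K)$ be a poset net bundle with pathwise connected fibre $F$. Equip $X$ with its canonical ordering $\prec$. Then for each $a\in K$ and $x\in X_a$ there is a morphism $j_a:\pi_1(X_a,x)\to\pi_1(X,x)$, with $\pi_1(X_a,x)\simeq\pi_1(F,a')$ for $a'\in F$, and an exact sequence $$\pi_1(X_a,x)\xrightarrow{\,j_a\,}\pi_1(X,x)\xrightarrow{\,\eta_*\,}\pi_1(K,a)\to \mathbf{0}.$$ In particular, if $(F,\leq)$ is simply connected, then $\eta_*$ is an isomorphism.
   Context: Homotopy of a poset $K$: a $1$-simplex $b=(|b|;\partial_0b,\partial_1b)$ consists of elements of $K$ with $\partial_0b,\partial_1b\leq|b|$. A $2$-simplex $c$ consists of $1$-simplices $\partial_0c,\partial_1c,\partial_2c$ and $|c|\in K$ with $|\partial_ic|\leq|c|$, satisfying $\partial_0\partial_1c=\partial_0\partial_0c$, $\partial_0\partial_2c=\partial_1\partial_0c$, $\partial_1\partial_2c=\partial_1\partial_1c$. A path is $p=b_n*\cdots*b_1$ with $\partial_0b_i=\partial_1b_{i+1}$, going from $\partial_1b_1$ to $\partial_0b_n$. $K$ is pathwise connected if any two elements are joined by a path. Homotopy of paths is generated by replacing a $1$-simplex $\partial_1c$ of a path by $\partial_0c*\partial_2c$, or conversely, for $2$-simplices $c$. $\pi_1(K,a)$ is the group of homotopy classes of closed paths at $a$ under concatenation, with identity the class of $(a;a,a)$. A pathwise connected poset is simply connected if $\pi_1$ is trivial. Order-preserving maps induce homomorphisms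 of $\pi_1$. Net bundle over $K$: $(X,\eta,J,K)$ with $\eta:X\to K$ a surjective map with fibres $X_a=\eta^{-1}(a)$, and bijections $J_{(a',a)}:X_a\to X_{a'}$ for all $a\leq a'$ in $K$, with $J_{(a,a)}=\mathrm{id}$ and $J_{(a'',a')}J_{(a',a)}=J_{(a'',a)}$ for $a\leq a'\leq a''$. It is a poset net bundle if each $X_a$ carries a partial order $\leq_a$ and each $J_{(a',a)}$ is an isomorphism of posets. Over a pathwise connected $K$ all fibres are isomorphic to a fixed poset $F$, the (standard) fibre. The canonical ordering on $X$: $x_1\prec x_0$ iff $a_1:=\eta(x_1)\leq a_0:=\eta(x_0)$ and $J_{(a_0,a_1)}(x_1)\leq_{a_0}x_0$. With it $\eta$ and the inclusion $X_a\hookrightarrow X$ are order preserving; $j_a$ is induced by this inclusion. *)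

theory Defs
  imports "HOL-Algebra.Exact_Sequence"
begin

text \<open>
  A poset is a carrier set \<open>A\<close> with a relation \<open>r\<close> such that \<^const>\<open>partial_order_on\<close> \<open>A r\<close>;
  \<open>(x, y) \<in> r\<close> means \<open>x \<le> y\<close>.
\<close>

section \<open>Homotopy of posets\<close>

datatype 'a simplex1 = Simplex1 (supp1: 'a) (bd0: 'a) (bd1: 'a)

datatype 'a simplex2 =
  Simplex2 (supp2: 'a) (face0: "'a simplex1") (face1: "'a simplex1") (face2: "'a simplex1")

definition simplices1 :: "'a set \<Rightarrow> 'a rel \<Rightarrow> 'a simplex1 set" where
  "simplices1 A r = {b. supp1 b \<in> A \<and> bd0 b \<in> A \<and> bd1 b \<in> A \<and>
                        (bd0 b, supp1 b) \<in> r \<and> (bd1 b, supp1 b) \<in> r}"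

definition simplices2 :: "'a set \<Rightarrow> 'a rel \<Rightarrow> 'a simplex2 set" where
  "simplices2 A r = {c. supp2 c \<in> A \<and>
     face0 c \<in> simplices1 A r \<and> face1 c \<in> simplices1 A r \<and> face2 c \<in> simplices1 A r \<and>
     (supp1 (face0 c), supp2 c) \<in> r \<and> (supp1 (face1 c), supp2 c) \<in> r \<and>
     (supp1 (face2 c), supp2 c) \<in> r \<and>
     bd0 (face1 c) = bd0 (face0 c) \<and> bd0 (face2 c) = bd1 (face0 c) \<and>
     bd1 (face2 c) = bd1 (face1 c)}"

text \<open>
  The path \<open>b\<^sub>n * \<dots> * b\<^sub>1\<close> is the nonempty list \<open>[b\<^sub>n, \<dots>, b\<^sub>1]\<close>, so that \<open>*\<close> is \<open>@\<close> and the list is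
  traversed from its last to its first element.  \<open>paths A r a b\<close> are the paths from \<open>a\<close> to \<open>b\<close>.
\<close>

definition paths :: "'a set \<Rightarrow> 'a rel \<Rightarrow> 'a \<Rightarrow> 'a \<Rightarrow> 'a simplex1 list set" where
  "paths A r a b = {p. p \<noteq> [] \<and> set p \<subseteq> simplices1 A r \<and>
     successively (\<lambda>b' b. bd0 b = bd1 b') p \<and> bd1 (last p) = a \<and> bd0 (hd p) = b}"

definition pathwise_connected :: "'a set \<Rightarrow> 'a rel \<Rightarrow> bool" where
  "pathwise_connected A r \<longleftrightarrow> (\<forall>a\<in>A. \<forall>b\<in>A. paths A r a b \<noteq> {})"

definition elementary_deformation ::
  "'a set \<Rightarrow> 'a rel \<Rightarrow> 'a simplex1 list \<Rightarrow> 'a simplex1 list \<Rightarrow> bool" where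
  "elementary_deformation A r p q \<longleftrightarrow>
     (\<exists>c\<in>simplices2 A r. \<exists>u v. p = u @ [face1 c] @ v \<and> q = u @ [face0 c, face2 c] @ v)"

definition homotopy :: "'a set \<Rightarrow> 'a rel \<Rightarrow> 'a \<Rightarrow> 'a \<Rightarrow> 'a simplex1 list rel" where
  "homotopy A r a b = {(p, q). p \<in> paths A r a b \<and> q \<in> paths A r a b \<and>
                               equivclp (elementary_deformation A r) p q}"

definition pi1 :: "'a set \<Rightarrow> 'a rel \<Rightarrow> 'a \<Rightarrow> 'a simplex1 list set monoid" where
  "pi1 A r a = \<lparr>carrier = paths A r a a // homotopy A r a a,
     monoid.mult = (\<lambda>P Q. \<Union>p\<in>P. \<Union>q\<in>Q. homotopy A r a a `` {p @ q}),
     one = homotopy A r a a `` {[Simplex1 a a a]}\<rparr>"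

definition simply_connected_poset :: "'a set \<Rightarrow> 'a rel \<Rightarrow> bool" where
  "simply_connected_poset A r \<longleftrightarrow>
     pathwise_connected A r \<and> (\<forall>a\<in>A. trivial_group (pi1 A r a))"

text \<open>
  The map \<open>[p] \<mapsto> [f p]\<close> on homotopy classes of closed paths at \<open>a\<close> induced by an order preserving
  map \<open>f\<close> into the poset \<open>(B, s)\<close>.
\<close>

definition pi1_map ::
  "'b set \<Rightarrow> 'b rel \<Rightarrow> ('a \<Rightarrow> 'b) \<Rightarrow> 'a \<Rightarrow> 'a simplex1 list set \<Rightarrow> 'b simplex1 list set" where
  "pi1_map B s f a P = (\<Union>p\<in>P. homotopy B s (f a) (f a) `` {map (map_simplex1 f) p})"

text \<open>
  Exactness at \<open>H\<close> of \<open>G \<rightarrow> H \<rightarrow> L\<close>; the library's \<^const>\<open>exact_seq\<close> requires all groups to have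
  elements of one and the same type.
\<close>

definition exact_at :: "'a monoid \<Rightarrow> ('a \<Rightarrow> 'b) \<Rightarrow> 'b monoid \<Rightarrow> ('b \<Rightarrow> 'c) \<Rightarrow> 'c monoid \<Rightarrow> bool" where
  "exact_at G f H g L \<longleftrightarrow> group_hom G H f \<and> group_hom H L g \<and> f ` carrier G = kernel H L g"


section \<open>Net bundles\<close>

definition poset_iso_on :: "'a set \<Rightarrow> 'a rel \<Rightarrow> 'b set \<Rightarrow> 'b rel \<Rightarrow> ('a \<Rightarrow> 'b) \<Rightarrow> bool" where
  "poset_iso_on A r B s f \<longleftrightarrow>
     bij_betw f A B \<and> (\<forall>x\<in>A. \<forall>y\<in>A. (x, y) \<in> r \<longleftrightarrow> (f x, f y) \<in> s)"

definition fibre :: "'x set \<Rightarrow> ('x \<Rightarrow> 'k) \<Rightarrow> 'k \<Rightarrow> 'x set" where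
  "fibre X eta a = {x \<in> X. eta x = a}"

locale net_bundle =
  fixes K :: "'k set" and leK :: "'k rel"
    and X :: "'x set" and eta :: "'x \<Rightarrow> 'k" and J :: "'k \<Rightarrow> 'k \<Rightarrow> 'x \<Rightarrow> 'x"
  assumes poset_base: "partial_order_on K leK"
    and proj_surj: "eta ` X = K"
    and J_bij: "(a, a') \<in> leK \<Longrightarrow> bij_betw (J a' a) (fibre X eta a) (fibre X eta a')"
    and J_refl: "a \<in> K \<Longrightarrow> x \<in> fibre X eta a \<Longrightarrow> J a a x = x"
    and J_comp: "(a, a') \<in> leK \<Longrightarrow> (a', a'') \<in> leK \<Longrightarrow> x \<in> fibre X eta a \<Longrightarrow>
                   J a'' a' (J a' a x) = J a'' a x"

locale poset_net_bundle = net_bundle K leK X eta J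
  for K :: "'k set" and leK :: "'k rel"
    and X :: "'x set" and eta :: "'x \<Rightarrow> 'k" and J :: "'k \<Rightarrow> 'k \<Rightarrow> 'x \<Rightarrow> 'x" +
  fixes leX :: "'k \<Rightarrow> 'x rel"
  assumes poset_fibre: "a \<in> K \<Longrightarrow> partial_order_on (fibre X eta a) (leX a)"
    and J_iso: "(a, a') \<in> leK \<Longrightarrow>
                  poset_iso_on (fibre X eta a) (leX a) (fibre X eta a') (leX a') (J a' a)"

definition canonical_order ::
  "'k rel \<Rightarrow> 'x set \<Rightarrow> ('x \<Rightarrow> 'k) \<Rightarrow> ('k \<Rightarrow> 'k \<Rightarrow> 'x \<Rightarrow> 'x) \<Rightarrow> ('k \<Rightarrow> 'x rel) \<Rightarrow> 'x rel" where
  "canonical_order leK X eta J leX =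
     {(x1, x0). x1 \<in> X \<and> x0 \<in> X \<and> (eta x1, eta x0) \<in> leK \<and> (J (eta x0) (eta x1) x1, x0) \<in> leX (eta x0)}"

text \<open>
  The poset \<open>(F, leF)\<close>, possibly living on another type, is a standard fibre if all the fibres are
  isomorphic to it.  Over a pathwise connected base each of the fibres is one, see
  \<open>fibre_standard\<close> below.
\<close>

definition standard_fibre ::
  "'f set \<Rightarrow> 'f rel \<Rightarrow> 'k set \<Rightarrow> 'x set \<Rightarrow> ('x \<Rightarrow> 'k) \<Rightarrow> ('k \<Rightarrow> 'x rel) \<Rightarrow> bool" where
  "standard_fibre F leF K X eta leX \<longleftrightarrow> partial_order_on F leF \<and>
     (\<forall>a\<in>K. \<exists>f. poset_iso_on F leF (fibre X eta a) (leX a) f)"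


section \<open>Well-definedness\<close>

lemma elementary_deformation_context:
  assumes "elementary_deformation A r p q"
  shows "elementary_deformation A r (u @ p @ v) (u @ q @ v)"
proof -
  obtain c u' v' where c: "c \<in> simplices2 A r"
    and pq: "p = u' @ [face1 c] @ v'" "q = u' @ [face0 c, face2 c] @ v'"
    using assms unfolding elementary_deformation_def by blast
  show ?thesis
    unfolding elementary_deformation_def using c
    by (intro bexI[of _ c] exI[of _ "u @ u'"] exI[of _ "v' @ v"]) (simp_all add: pq)
qed

lemma equivclp_deformation_context:
  assumes "equivclp (elementary_deformation A r) p q"
  shows "equivclp (elementary_deformation A r) (u @ p @ v) (u @ q @ v)"
  using assms
proof (induction rule: equivclp_induct)
  case base
  then show ?case by simp
next
  case (step y z)
  have "equivclp (elementary_deformation A r) (u @ y @ v) (u @ z @ v)"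
    using step.hyps(2) elementary_deformation_context
    by (blast intro: r_into_equivclp converse_r_into_equivclp)
  with step.IH show ?case by (rule equivclp_trans)
qed

lemma paths_append: "p \<in> paths A r b c \<Longrightarrow> q \<in> paths A r a b \<Longrightarrow> p @ q \<in> paths A r a c"
  by (auto simp: paths_def successively_append_iff)

lemma equiv_homotopy: "equiv (paths A r a b) (homotopy A r a b)"
proof (rule equivI)
  show "refl_on (paths A r a b) (homotopy A r a b)"
    by (simp add: homotopy_def refl_on_def)
  show "sym (homotopy A r a b)"
    by (rule symI) (simp add: homotopy_def equivclp_sym)
  show "trans (homotopy A r a b)"
    by (rule transI) (simp add: homotopy_def, blast intro: equivclp_trans)
qed (auto simp: homotopy_def)

lemma homotopy_append:
  assumes "(p, p') \<in> homotopy A r a a" "(q, q') \<in> homotopy A r a a"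
  shows "(p @ q, p' @ q') \<in> homotopy A r a a"
proof -
  have "equivclp (elementary_deformation A r) (p @ q) (p' @ q)"
    using assms(1) equivclp_deformation_context[of A r p p' "[]" q] by (simp add: homotopy_def)
  moreover have "equivclp (elementary_deformation A r) (p' @ q) (p' @ q')"
    using assms(2) equivclp_deformation_context[of A r q q' p' "[]"] by (simp add: homotopy_def)
  ultimately have "equivclp (elementary_deformation A r) (p @ q) (p' @ q')"
    by (rule equivclp_trans)
  with assms show ?thesis
    by (simp add: homotopy_def paths_append[of _ A r a a _ a])
qed

lemma pi1_mult_class:
  assumes "p \<in> paths A r a a" "q \<in> paths A r a a"
  shows "homotopy A r a a `` {p} \<otimes>\<^bsub>pi1 A r a\<^esub> homotopy A r a a `` {q} = homotopy A r a a `` {p @ q}"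
proof -
  have "homotopy A r a a `` {p' @ q'} = homotopy A r a a `` {p @ q}"
    if "(p, p') \<in> homotopy A r a a" "(q, q') \<in> homotopy A r a a" for p' q'
    using equiv_class_eq[OF equiv_homotopy homotopy_append[OF that]] by simp
  moreover have "(p, p) \<in> homotopy A r a a" "(q, q) \<in> homotopy A r a a"
    using assms by (auto simp: homotopy_def)
  ultimately show ?thesis
    unfolding pi1_def monoid.simps Image_singleton by (intro equalityI) blast+
qed

lemma homotopy_unit:
  assumes "partial_order_on A r" "p \<in> paths A r a a"
  shows "([Simplex1 a a a] @ p, p) \<in> homotopy A r a a"
proof -
  obtain b v where p: "p = b # v" using assms(2) by (auto simp: paths_def neq_Nil_conv)
  have b: "b \<in> simplices1 A r" "bd0 b = a" using assms(2) by (auto simp: p paths_def)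
  have rf: "(x, x) \<in> r" if "x \<in> A" for x
    using assms(1) that by (auto simp: refl_on_def dest: partial_order_onD(1))
  have "Simplex2 (supp1 b) (Simplex1 a a a) b b \<in> simplices2 A r"
    using b rf by (auto simp: simplices2_def simplices1_def)
  then have "elementary_deformation A r p ([Simplex1 a a a] @ p)"
    unfolding elementary_deformation_def p
    by (intro bexI[of _ "Simplex2 (supp1 b) (Simplex1 a a a) b b"] exI[of _ "[]"] exI[of _ v]) auto
  moreover have "[Simplex1 a a a] \<in> paths A r a a"
    using b rf by (auto simp: paths_def simplices1_def)
  ultimately show ?thesis
    using assms(2) paths_append[of "[Simplex1 a a a]" A r a a p a]
    by (simp add: homotopy_def converse_r_into_equivclp)
qed

lemma homotopy_inverse:
  assumes "partial_order_on A r" "p \<in> paths A r a b"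
  shows "\<exists>q \<in> paths A r b a. equivclp (elementary_deformation A r) (q @ p) [Simplex1 a a a]"
proof -
  have rf: "(x, x) \<in> r" if "x \<in> A" for x
    using assms(1) that by (auto simp: refl_on_def dest: partial_order_onD(1))
  have one: "\<exists>s'. s' \<in> simplices1 A r \<and> bd0 s' = bd1 s \<and> bd1 s' = bd0 s \<and>
      equivclp (elementary_deformation A r) [s', s] [Simplex1 (bd1 s) (bd1 s) (bd1 s)]"
    if s: "s \<in> simplices1 A r" for s
  proof (intro exI[of _ "Simplex1 (supp1 s) (bd1 s) (bd0 s)"] conjI)
    let ?s = "Simplex1 (supp1 s) (bd1 s) (bd0 s)" and ?e = "Simplex1 (bd1 s) (bd1 s) (bd1 s)"
    have "Simplex2 (supp1 s) ?s ?e s \<in> simplices2 A r"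
      using s rf by (auto simp: simplices2_def simplices1_def)
    then have "elementary_deformation A r [?e] [?s, s]"
      unfolding elementary_deformation_def
      by (intro bexI[of _ "Simplex2 (supp1 s) ?s ?e s"] exI[of _ "[]"]) auto
    then show "equivclp (elementary_deformation A r) [?s, s] [?e]"
      by (rule converse_r_into_equivclp)
  qed (use s in \<open>auto simp: simplices1_def\<close>)
  have "p \<noteq> []" using assms(2) by (simp add: paths_def)
  then show ?thesis using assms(2)
  proof (induction p arbitrary: b rule: list_nonempty_induct)
    case (single s)
    then obtain s' where "s' \<in> simplices1 A r" "bd0 s' = bd1 s" "bd1 s' = bd0 s"
      "equivclp (elementary_deformation A r) [s', s] [Simplex1 (bd1 s) (bd1 s) (bd1 s)]"
      using one[of s] by (auto simp: paths_def)
    then show ?case using single by (intro bexI[of _ "[s']"]) (auto simp: paths_def)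
  next
    case (cons s p)
    then have s: "s \<in> simplices1 A r" "bd0 s = b" and p: "p \<in> paths A r a (bd1 s)"
      by (auto simp: paths_def successively_Cons)
    obtain s' where s': "s' \<in> simplices1 A r" "bd0 s' = bd1 s" "bd1 s' = bd0 s"
      "equivclp (elementary_deformation A r) [s', s] [Simplex1 (bd1 s) (bd1 s) (bd1 s)]"
      using one[of s] s by auto
    obtain q where q: "q \<in> paths A r (bd1 s) a"
      "equivclp (elementary_deformation A r) (q @ p) [Simplex1 a a a]"
      using cons.IH[OF p] by auto
    let ?e = "Simplex1 (bd1 s) (bd1 s) (bd1 s)"
    obtain t v where t: "p = t # v" using \<open>p \<noteq> []\<close> by (auto simp: neq_Nil_conv)
    have tt: "t \<in> simplices1 A r" "bd0 t = bd1 s" using p by (auto simp: t paths_def)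
    have "Simplex2 (supp1 t) ?e t t \<in> simplices2 A r"
      using tt rf by (auto simp: simplices2_def simplices1_def)
    then have "elementary_deformation A r p (?e # p)"
      unfolding elementary_deformation_def t
      by (intro bexI[of _ "Simplex2 (supp1 t) ?e t t"] exI[of _ "[]"] exI[of _ v]) auto
    then have 1: "equivclp (elementary_deformation A r) (q @ ?e # p) (q @ p)"
      using equivclp_deformation_context[OF converse_r_into_equivclp, of A r p "?e # p" q "[]"]
      by simp
    have 2: "equivclp (elementary_deformation A r) ((q @ [s']) @ (s # p)) (q @ ?e # p)"
      using equivclp_deformation_context[OF s'(4), of q p] by simp
    have "[s'] \<in> paths A r b (bd1 s)" using s s' by (auto simp: paths_def)
    then have "q @ [s'] \<in> paths A r b a" using paths_append[OF q(1)] by blast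
    moreover have "equivclp (elementary_deformation A r) ((q @ [s']) @ (s # p)) [Simplex1 a a a]"
      using equivclp_trans[OF 2 equivclp_trans[OF 1 q(2)]] .
    ultimately show ?case by blast
  qed
qed

lemma group_pi1:
  assumes A: "partial_order_on A r" "a \<in> A"
  shows "group (pi1 A r a)"
proof (rule groupI)
  let ?cl = "\<lambda>p. homotopy A r a a `` {p}"
  have e: "[Simplex1 a a a] \<in> paths A r a a"
    using A partial_order_onD(1)[OF A(1)] by (auto simp: paths_def simplices1_def refl_on_def)
  have car: "carrier (pi1 A r a) = ?cl ` paths A r a a"
    by (auto simp: pi1_def quotient_def)
  have one: "\<one>\<^bsub>pi1 A r a\<^esub> = ?cl [Simplex1 a a a]" by (simp add: pi1_def)
  show "\<one>\<^bsub>pi1 A r a\<^esub> \<in> carrier (pi1 A r a)" using e by (simp add: car one)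
  show "x \<otimes>\<^bsub>pi1 A r a\<^esub> y \<in> carrier (pi1 A r a)"
    if "x \<in> carrier (pi1 A r a)" "y \<in> carrier (pi1 A r a)" for x y
    using that by (auto simp: car pi1_mult_class paths_append[of _ A r a a _ a])
  show "x \<otimes>\<^bsub>pi1 A r a\<^esub> y \<otimes>\<^bsub>pi1 A r a\<^esub> z = x \<otimes>\<^bsub>pi1 A r a\<^esub> (y \<otimes>\<^bsub>pi1 A r a\<^esub> z)"
    if "x \<in> carrier (pi1 A r a)" "y \<in> carrier (pi1 A r a)" "z \<in> carrier (pi1 A r a)" for x y z
    using that by (auto simp: car pi1_mult_class paths_append[of _ A r a a _ a])
  show "\<one>\<^bsub>pi1 A r a\<^esub> \<otimes>\<^bsub>pi1 A r a\<^esub> x = x" if x: "x \<in> carrier (pi1 A r a)" for x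
  proof -
    obtain p where p: "p \<in> paths A r a a" "x = ?cl p" using x by (auto simp: car)
    then show ?thesis
      using homotopy_unit[OF A(1) p(1)] pi1_mult_class[OF e p(1)] equiv_class_eq[OF equiv_homotopy]
      by (simp add: one)
  qed
  show "\<exists>y\<in>carrier (pi1 A r a). y \<otimes>\<^bsub>pi1 A r a\<^esub> x = \<one>\<^bsub>pi1 A r a\<^esub>"
    if x: "x \<in> carrier (pi1 A r a)" for x
  proof -
    obtain p where p: "p \<in> paths A r a a" "x = ?cl p" using x by (auto simp: car)
    obtain q where q: "q \<in> paths A r a a"
      "equivclp (elementary_deformation A r) (q @ p) [Simplex1 a a a]"
      using homotopy_inverse[OF A(1) p(1)] by auto
    have h: "(q @ p, [Simplex1 a a a]) \<in> homotopy A r a a"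
      using q e paths_append[OF q(1) p(1)] by (simp add: homotopy_def)
    have "?cl q \<otimes>\<^bsub>pi1 A r a\<^esub> x = \<one>\<^bsub>pi1 A r a\<^esub>"
      using pi1_mult_class[OF q(1) p(1)] equiv_class_eq[OF equiv_homotopy h] by (simp add: p one)
    then show ?thesis
      using q(1) by (intro bexI[of _ "?cl q"]) (auto simp: car)
  qed
qed

context poset_net_bundle
begin

lemma canonical_order_poset: "partial_order_on X (canonical_order leK X eta J leX)"
proof -
  let ?c = "canonical_order leK X eta J leX"
  have fib: "x \<in> fibre X eta (eta x)" "eta x \<in> K" if "x \<in> X" for x
    using that proj_surj by (auto simp: fibre_def)
  have "refl_on X ?c"
    using fib J_refl poset_base poset_fibre
    by (fastforce simp: refl_on_def canonical_order_def partial_order_on_def preorder_on_def)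
  moreover have "trans ?c"
  proof (rule transI)
    fix x y z assume xy: "(x, y) \<in> ?c" and yz: "(y, z) \<in> ?c"
    have X: "x \<in> X" "y \<in> X" "z \<in> X" and k: "(eta x, eta y) \<in> leK" "(eta y, eta z) \<in> leK"
      and l: "(J (eta y) (eta x) x, y) \<in> leX (eta y)" "(J (eta z) (eta y) y, z) \<in> leX (eta z)"
      using xy yz by (auto simp: canonical_order_def)
    have "J (eta y) (eta x) x \<in> fibre X eta (eta y)"
      using J_bij[OF k(1)] fib[OF X(1)] by (auto simp: bij_betw_def)
    then have "(J (eta z) (eta y) (J (eta y) (eta x) x), J (eta z) (eta y) y) \<in> leX (eta z)"
      using J_iso[OF k(2)] fib(1)[OF X(2)] l(1) by (auto simp: poset_iso_on_def)
    then have "(J (eta z) (eta x) x, z) \<in> leX (eta z)"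
      using J_comp[OF k fib(1)[OF X(1)]] l(2) poset_fibre[OF fib(2)[OF X(3)]]
      by (metis partial_order_onD(2) transD)
    then show "(x, z) \<in> ?c"
      using X k partial_order_onD(2)[OF poset_base] by (auto simp: canonical_order_def dest: transD)
  qed
  moreover have "antisym ?c"
  proof (rule antisymI)
    fix x y assume xy: "(x, y) \<in> ?c" "(y, x) \<in> ?c"
    then have eq: "eta x = eta y" and X: "x \<in> X" "y \<in> X"
      using partial_order_onD(3)[OF poset_base] by (auto simp: canonical_order_def dest: antisymD)
    then show "x = y"
      using xy J_refl fib poset_fibre[OF fib(2)[OF X(1)]]
      by (metis (no_types, lifting) canonical_order_def antisymD case_prodD mem_Collect_eq partial_order_onD(3))
  qed
  ultimately show ?thesis
    by (auto simp: partial_order_on_def preorder_on_def canonical_order_def)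
qed

lemma fibre_standard:
  assumes "pathwise_connected K leK" and a: "a \<in> K"
  shows "standard_fibre (fibre X eta a) (leX a) K X eta leX"
proof -
  define R where "R c d \<longleftrightarrow>
    (\<exists>f. poset_iso_on (fibre X eta c) (leX c) (fibre X eta d) (leX d) f)" for c d
  have R_sym: "R d c" if "R c d" for c d
  proof -
    obtain f where "poset_iso_on (fibre X eta c) (leX c) (fibre X eta d) (leX d) f"
      using \<open>R c d\<close> unfolding R_def by blast
    then have f: "bij_betw f (fibre X eta c) (fibre X eta d)"
      "\<forall>x\<in>fibre X eta c. \<forall>y\<in>fibre X eta c. (x, y) \<in> leX c \<longleftrightarrow> (f x, f y) \<in> leX d"
      by (simp_all add: poset_iso_on_def)
    have "poset_iso_on (fibre X eta d) (leX d) (fibre X eta c) (leX c) (inv_into (fibre X eta c) f)"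
      unfolding poset_iso_on_def
      using f bij_betw_inv_into[OF f(1)]
      by (simp add: bij_betw_inv_into_right[OF f(1)] bij_betw_apply[OF bij_betw_inv_into[OF f(1)]])
    then show ?thesis unfolding R_def by blast
  qed
  have R_trans: "R c e" if "R c d" "R d e" for c d e
  proof -
    obtain f g where "poset_iso_on (fibre X eta c) (leX c) (fibre X eta d) (leX d) f"
      "poset_iso_on (fibre X eta d) (leX d) (fibre X eta e) (leX e) g"
      using \<open>R c d\<close> \<open>R d e\<close> unfolding R_def by blast
    then have "poset_iso_on (fibre X eta c) (leX c) (fibre X eta e) (leX e) (g \<circ> f)"
      unfolding poset_iso_on_def
      by (metis (no_types, lifting) bij_betw_trans bij_betw_apply comp_apply)
    then show ?thesis unfolding R_def by blast
  qed
  have R_J: "R c d" if "(c, d) \<in> leK" for c d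
    unfolding R_def using J_iso[OF that] by (intro exI[of _ "J d c"])
  have step: "R (bd1 s) (bd0 s)" if "s \<in> simplices1 K leK" for s
  proof (rule R_trans)
    have "(bd1 s, supp1 s) \<in> leK" "(bd0 s, supp1 s) \<in> leK"
      using that by (simp_all add: simplices1_def)
    then show "R (bd1 s) (supp1 s)" "R (supp1 s) (bd0 s)"
      by (simp_all add: R_J R_sym)
  qed
  have "R (bd1 (last p)) (bd0 (hd p))"
    if "p \<noteq> []" "set p \<subseteq> simplices1 K leK" "successively (\<lambda>b' b. bd0 b = bd1 b') p" for p
    using that
  proof (induction p rule: list_nonempty_induct)
    case (single s)
    then show ?case using step by auto
  next
    case (cons s p)
    then have "R (bd1 (last p)) (bd1 s)" "R (bd1 s) (bd0 s)"
      using step[of s] by (simp_all add: successively_Cons)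
    then have "R (bd1 (last p)) (bd0 s)" by (rule R_trans)
    then show ?case using cons.hyps by simp
  qed
  note R_path = this
  have "R a b" if b: "b \<in> K" for b
  proof -
    obtain p where "p \<in> paths K leK a b"
      using assms(1) a b unfolding pathwise_connected_def by blast
    then show ?thesis
      using R_path[of p] by (simp add: paths_def)
  qed
  then show ?thesis
    using poset_fibre[OF a] unfolding standard_fibre_def R_def by simp
qed

end

end

theory Submission
  imports Defs
begin

text \<open>
  The bijections \<open>J\<close> transport points along each 1-simplex \<open>b\<close> of \<open>K\<close>, by
  \<open>J\<^bsub>(|b|, \<partial>\<^sub>0b)\<^esub>\<inverse> J\<^bsub>(|b|, \<partial>\<^sub>1b)\<^esub>\<close>, and so paths of \<open>K\<close> lift uniquely to horizontal paths of \<open>X\<close>;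
  homotopies lift as well.  Every 1-simplex of \<open>X\<close> is homotopic to a horizontal one followed by one
  in a fibre, and fibre simplices can be moved past horizontal ones.  Hence a path \<open>p\<close> from \<open>x\<close> is
  homotopic to the horizontal lift of \<open>\<eta>(p)\<close> at \<open>x\<close> followed by a path in a fibre.  If \<open>\<eta>(p)\<close> is
  null homotopic, so is its lift, which leaves a closed path in the fibre of \<open>x\<close>: this is exactness at
  \<open>\<pi>\<^sub>1(X, x)\<close>.  Since the fibres are connected, the lift of a closed path of \<open>K\<close> can be closed up
  in the fibre, whence \<open>\<eta>\<^sub>*\<close> is surjective.
\<close>

section \<open>Homotopies of paths\<close>

abbreviation homotopic :: "'a set \<Rightarrow> 'a rel \<Rightarrow> 'a simplex1 list \<Rightarrow> 'a simplex1 list \<Rightarrow> bool" where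
  "homotopic A r \<equiv> equivclp (elementary_deformation A r)"

abbreviation const_simplex :: "'a \<Rightarrow> 'a simplex1" where
  "const_simplex a \<equiv> Simplex1 a a a"

lemma homotopic_append:
  assumes "homotopic A r p p'" "homotopic A r q q'"
  shows "homotopic A r (p @ q) (p' @ q')"
  using equivclp_trans[OF equivclp_deformation_context[OF assms(1), of "[]" q]]
    equivclp_deformation_context[OF assms(2), of p' "[]"]
  by simp

lemma homotopic_simplex2:
  assumes "c \<in> simplices2 A r"
  shows "homotopic A r [face1 c] [face0 c, face2 c]"
proof -
  have "elementary_deformation A r [face1 c] [face0 c, face2 c]"
    unfolding elementary_deformation_def
    using assms by (intro bexI[of _ c] exI[of _ "[]"]) auto
  then show ?thesis by (rule r_into_equivclp)
qed

lemma paths_single: "[s] \<in> paths A r a b \<longleftrightarrow> s \<in> simplices1 A r \<and> bd1 s = a \<and> bd0 s = b"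
  by (auto simp: paths_def)

lemma paths_Cons:
  "p \<noteq> [] \<Longrightarrow> s # p \<in> paths A r a b \<longleftrightarrow> s \<in> simplices1 A r \<and> bd0 s = b \<and> p \<in> paths A r a (bd1 s)"
  by (auto simp: paths_def successively_Cons)

text \<open>The face identities of a 2-simplex say that \<open>face1 c\<close> and
  \<open>face0 c\<close> after \<open>face2 c\<close> have the same endpoints, so either piece fits
  between the same neighbours and all three faces are 1-simplices.\<close>

lemma elementary_deformation_paths:
  assumes "elementary_deformation A r p q"
  shows "p \<in> paths A r a b \<longleftrightarrow> q \<in> paths A r a b"
proof -
  obtain c u v where c: "c \<in> simplices2 A r"
    and pq: "p = u @ [face1 c] @ v" "q = u @ [face0 c, face2 c] @ v"
    using assms unfolding elementary_deformation_def by blast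
  show ?thesis
    using c unfolding pq
    by (cases u; cases v)
      (auto simp: paths_def simplices2_def successively_append_iff successively_Cons hd_append)
qed

lemma homotopic_paths:
  assumes "homotopic A r p q"
  shows "p \<in> paths A r a b \<longleftrightarrow> q \<in> paths A r a b"
  using assms
proof (induction rule: equivclp_induct)
  case base
  show ?case ..
next
  case (step q q')
  then show ?case
    using elementary_deformation_paths[of A r q q' a b] elementary_deformation_paths[of A r q' q a b]
    by blast
qed

text \<open>Since deformations keep endpoints, membership of the second path follows from that of
  the first; classes can then be handled through \<open>homotopic\<close> alone.\<close>

lemma homotopy_iff:
  "(p, q) \<in> homotopy A r a b \<longleftrightarrow> p \<in> paths A r a b \<and> homotopic A r p q"
  using homotopic_paths[of A r p q a b] by (auto simp: homotopy_def)

lemma homotopy_class_eq_iff: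
  assumes "p \<in> paths A r a a"
  shows "homotopy A r a a `` {p} = homotopy A r a a `` {q} \<longleftrightarrow> homotopic A r p q"
proof
  assume "homotopy A r a a `` {p} = homotopy A r a a `` {q}"
  moreover have "p \<in> homotopy A r a a `` {p}"
    using assms by (simp add: homotopy_iff)
  ultimately show "homotopic A r p q"
    by (auto simp: homotopy_iff intro: equivclp_sym)
next
  assume "homotopic A r p q"
  with assms show "homotopy A r a a `` {p} = homotopy A r a a `` {q}"
    by (intro equiv_class_eq[OF equiv_homotopy]) (simp add: homotopy_iff)
qed

lemma carrier_pi1: "carrier (pi1 A r a) = (\<lambda>p. homotopy A r a a `` {p}) ` paths A r a a"
  by (auto simp: pi1_def quotient_def)

lemma one_pi1: "\<one>\<^bsub>pi1 A r a\<^esub> = homotopy A r a a `` {[const_simplex a]}"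
  by (simp add: pi1_def)

section \<open>Units and two-sided inverses for paths with arbitrary endpoints\<close>

lemma partial_order_onD_refl: "partial_order_on A r \<Longrightarrow> a \<in> A \<Longrightarrow> (a, a) \<in> r"
  by (auto simp: refl_on_def dest: partial_order_onD(1))

lemma const_path:
  assumes "partial_order_on A r" "a \<in> A"
  shows "[const_simplex a] \<in> paths A r a a"
  using assms by (auto simp: paths_single simplices1_def partial_order_onD_refl)

lemma homotopic_unit_left:
  assumes "partial_order_on A r" "p \<in> paths A r a b"
  shows "homotopic A r (const_simplex b # p) p"
proof -
  obtain s v where p: "p = s # v" using assms(2) by (auto simp: paths_def neq_Nil_conv)
  have s: "s \<in> simplices1 A r" "bd0 s = b" using assms(2) by (auto simp: p paths_def)
  \<comment> \<open>A degenerate 2-simplex: \<open>face1\<close> and \<open>face2\<close> are both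
    \<open>s\<close>, so its deformation inserts the constant simplex after
    \<open>s\<close>.\<close>
  have "Simplex2 (supp1 s) (const_simplex b) s s \<in> simplices2 A r"
    using s partial_order_onD_refl[OF assms(1)] by (auto simp: simplices2_def simplices1_def)
  from homotopic_simplex2[OF this] have "homotopic A r [s] [const_simplex b, s]" by simp
  from equivclp_deformation_context[OF this, of "[]" v] show ?thesis
    by (simp add: p equivclp_sym)
qed

lemma homotopic_unit_right:
  assumes "partial_order_on A r" "p \<in> paths A r a b"
  shows "homotopic A r (p @ [const_simplex a]) p"
proof -
  obtain s v where p: "p = v @ [s]" using assms(2) by (cases p rule: rev_cases) (auto simp: paths_def)
  have s: "s \<in> simplices1 A r" "bd1 s = a" using assms(2) by (auto simp: p paths_def)
  have "Simplex2 (supp1 s) s s (const_simplex a) \<in> simplices2 A r"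
    using s partial_order_onD_refl[OF assms(1)] by (auto simp: simplices2_def simplices1_def)
  from homotopic_simplex2[OF this] have "homotopic A r [s] [s, const_simplex a]" by simp
  from equivclp_deformation_context[OF this, of v "[]"] show ?thesis
    by (simp add: p equivclp_sym)
qed

text \<open>\<open>homotopy_inverse\<close> gives left inverses only. A left inverse
  \<open>q\<close> of \<open>p\<close> has itself a left inverse \<open>p'\<close>; reducing
  \<open>p' @ q @ p\<close> from either side gives \<open>p'\<close> and \<open>p\<close>, so these
  are homotopic and \<open>q\<close> is also a right inverse of \<open>p\<close>.\<close>

lemma homotopic_inverse:
  assumes A: "partial_order_on A r" and p: "p \<in> paths A r a b"
  obtains q where "q \<in> paths A r b a"
    "homotopic A r (q @ p) [const_simplex a]" "homotopic A r (p @ q) [const_simplex b]"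
proof -
  obtain q where q: "q \<in> paths A r b a" "homotopic A r (q @ p) [const_simplex a]"
    using homotopy_inverse[OF A p] by blast
  obtain p' where p': "p' \<in> paths A r a b" "homotopic A r (p' @ q) [const_simplex b]"
    using homotopy_inverse[OF A q(1)] by blast
  have "homotopic A r (p' @ (q @ p)) (p' @ [const_simplex a])"
    using homotopic_append[OF equivclp_refl q(2)] .
  also have "homotopic A r (p' @ [const_simplex a]) p'"
    using homotopic_unit_right[OF A p'(1)] .
  finally have 1: "homotopic A r (p' @ (q @ p)) p'" .
  have "homotopic A r ((p' @ q) @ p) (const_simplex b # p)"
    using homotopic_append[OF p'(2) equivclp_refl, of p] by simp
  also have "homotopic A r (const_simplex b # p) p"
    using homotopic_unit_left[OF A p] .
  finally have "homotopic A r p p'"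
    using 1 by (metis append_assoc equivclp_sym equivclp_trans)
  from homotopic_append[OF this equivclp_refl, of q]
  have "homotopic A r (p @ q) [const_simplex b]"
    using p'(2) by (rule equivclp_trans)
  with q that show thesis by blast
qed


section \<open>Maps of fundamental groups\<close>

text \<open>A common form for \<open>pi1_map\<close> and for conjugation by a path, which acts on
  paths without coming from a map of posets. The union is a single class when \<open>h\<close>
  respects homotopy.\<close>

definition class_map ::
  "'b set \<Rightarrow> 'b rel \<Rightarrow> 'b \<Rightarrow> ('a simplex1 list \<Rightarrow> 'b simplex1 list) \<Rightarrow>
    'a simplex1 list set \<Rightarrow> 'b simplex1 list set" where
  "class_map B s b h P = (\<Union>p\<in>P. homotopy B s b b `` {h p})"

lemma class_map_class:
  assumes "\<And>p q. p \<in> paths A r a a \<Longrightarrow> homotopic A r p q \<Longrightarrow> homotopic B s (h p) (h q)"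
    and "\<And>p. p \<in> paths A r a a \<Longrightarrow> h p \<in> paths B s b b"
    and p: "p \<in> paths A r a a"
  shows "class_map B s b h (homotopy A r a a `` {p}) = homotopy B s b b `` {h p}"
proof -
  have "homotopy B s b b `` {h q} = homotopy B s b b `` {h p}"
    if "q \<in> homotopy A r a a `` {p}" for q
  proof -
    have "homotopic A r p q" using that by (simp add: homotopy_iff)
    then show ?thesis
      using assms homotopy_class_eq_iff[of "h p" B s b "h q"] by metis
  qed
  moreover have "p \<in> homotopy A r a a `` {p}"
    using p by (simp add: homotopy_iff)
  ultimately show ?thesis
    unfolding class_map_def by blast
qed

text \<open>Compatibility with concatenation is asked only up to homotopy, because conjugation by a
  path is multiplicative only after cancelling an inserted loop.\<close>

lemma class_map_hom:
  assumes resp: "\<And>p q. p \<in> paths A r a a \<Longrightarrow> homotopic A r p q \<Longrightarrow> homotopic B s (h p) (h q)"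
    and path: "\<And>p. p \<in> paths A r a a \<Longrightarrow> h p \<in> paths B s b b"
    and app: "\<And>p q. p \<in> paths A r a a \<Longrightarrow> q \<in> paths A r a a \<Longrightarrow>
                homotopic B s (h (p @ q)) (h p @ h q)"
  shows "class_map B s b h \<in> hom (pi1 A r a) (pi1 B s b)"
proof (rule homI)
  note cl = class_map_class[of A r a B s h b, OF resp path]
  show "class_map B s b h x \<in> carrier (pi1 B s b)" if "x \<in> carrier (pi1 A r a)" for x
    using that path by (auto simp: carrier_pi1 cl)
  show "class_map B s b h (x \<otimes>\<^bsub>pi1 A r a\<^esub> y) =
      class_map B s b h x \<otimes>\<^bsub>pi1 B s b\<^esub> class_map B s b h y"
    if xy: "x \<in> carrier (pi1 A r a)" "y \<in> carrier (pi1 A r a)" for x y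
  proof -
    obtain p q where p: "p \<in> paths A r a a" "x = homotopy A r a a `` {p}"
      and q: "q \<in> paths A r a a" "y = homotopy A r a a `` {q}"
      using xy by (auto simp: carrier_pi1)
    have pq: "p @ q \<in> paths A r a a" using paths_append p(1) q(1) .
    show ?thesis
      using homotopy_class_eq_iff[OF path[OF pq]] app[OF p(1) q(1)]
      by (simp add: p q cl pq pi1_mult_class path)
  qed
qed

text \<open>The map on classes given by \<open>k\<close> is a two-sided inverse of the one given by
  \<open>h\<close>, which yields bijectivity on the carriers.\<close>

lemma class_map_iso:
  assumes resp: "\<And>p q. p \<in> paths A r a a \<Longrightarrow> homotopic A r p q \<Longrightarrow> homotopic B s (h p) (h q)"
    and path: "\<And>p. p \<in> paths A r a a \<Longrightarrow> h p \<in> paths B s b b"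
    and app: "\<And>p q. p \<in> paths A r a a \<Longrightarrow> q \<in> paths A r a a \<Longrightarrow>
                homotopic B s (h (p @ q)) (h p @ h q)"
    and resp': "\<And>p q. p \<in> paths B s b b \<Longrightarrow> homotopic B s p q \<Longrightarrow> homotopic A r (k p) (k q)"
    and path': "\<And>p. p \<in> paths B s b b \<Longrightarrow> k p \<in> paths A r a a"
    and kh: "\<And>p. p \<in> paths A r a a \<Longrightarrow> homotopic A r (k (h p)) p"
    and hk: "\<And>p. p \<in> paths B s b b \<Longrightarrow> homotopic B s (h (k p)) p"
  shows "class_map B s b h \<in> iso (pi1 A r a) (pi1 B s b)"
proof -
  note cl = class_map_class[of A r a B s h b, OF resp path]
  note cl' = class_map_class[of B s b A r k a, OF resp' path']
  have "bij_betw (class_map B s b h) (carrier (pi1 A r a)) (carrier (pi1 B s b))"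
  proof (rule bij_betw_byWitness[where f' = "class_map A r a k"])
    show "\<forall>x\<in>carrier (pi1 A r a). class_map A r a k (class_map B s b h x) = x"
      using homotopy_class_eq_iff[OF path'[OF path]] kh by (auto simp: carrier_pi1 cl cl' path)
    show "\<forall>y\<in>carrier (pi1 B s b). class_map B s b h (class_map A r a k y) = y"
      using homotopy_class_eq_iff[OF path[OF path']] hk by (auto simp: carrier_pi1 cl cl' path')
    show "class_map B s b h ` carrier (pi1 A r a) \<subseteq> carrier (pi1 B s b)"
      using path by (auto simp: carrier_pi1 cl)
    show "class_map A r a k ` carrier (pi1 B s b) \<subseteq> carrier (pi1 A r a)"
      using path' by (auto simp: carrier_pi1 cl')
  qed
  with class_map_hom[of A r a B s h b, OF resp path app] show ?thesis
    by (simp add: iso_def)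
qed

lemma pi1_map_eq_class_map: "pi1_map B s f a = class_map B s (f a) (map (map_simplex1 f))"
  by (rule ext) (simp add: pi1_map_def class_map_def)

section \<open>Functoriality of the fundamental group under order-preserving maps\<close>

definition order_map :: "'a set \<Rightarrow> 'a rel \<Rightarrow> 'b set \<Rightarrow> 'b rel \<Rightarrow> ('a \<Rightarrow> 'b) \<Rightarrow> bool" where
  "order_map A r B s f \<longleftrightarrow> f ` A \<subseteq> B \<and> (\<forall>x\<in>A. \<forall>y\<in>A. (x, y) \<in> r \<longrightarrow> (f x, f y) \<in> s)"

lemma map_simplex1_ident: "map_simplex1 (\<lambda>y. y) = (\<lambda>t. t)"
  by (rule ext) (rule simplex1.map_ident)

lemma order_map_simplices1:
  "order_map A r B s f \<Longrightarrow> t \<in> simplices1 A r \<Longrightarrow> map_simplex1 f t \<in> simplices1 B s"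
  by (auto simp: order_map_def simplices1_def simplex1.map_sel)

lemma order_map_paths:
  assumes "order_map A r B s f" "p \<in> paths A r a b"
  shows "map (map_simplex1 f) p \<in> paths B s (f a) (f b)"
proof -
  have "successively (\<lambda>b' b. bd0 b = bd1 b') (map (map_simplex1 f) p)"
    using assms(2) unfolding successively_map paths_def
    by (auto simp: simplex1.map_sel elim!: successively_mono)
  then show ?thesis
    using assms order_map_simplices1[OF assms(1)]
    by (auto simp: paths_def last_map hd_map simplex1.map_sel)
qed

lemma order_map_homotopic:
  assumes f: "order_map A r B s f" and "homotopic A r p q"
  shows "homotopic B s (map (map_simplex1 f) p) (map (map_simplex1 f) q)"
proof -
  have *: "elementary_deformation B s (map (map_simplex1 f) p) (map (map_simplex1 f) q)"
    if "elementary_deformation A r p q" for p q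
  proof -
    obtain c u v where c: "c \<in> simplices2 A r"
      and pq: "p = u @ [face1 c] @ v" "q = u @ [face0 c, face2 c] @ v"
      using \<open>elementary_deformation A r p q\<close> unfolding elementary_deformation_def by blast
    have "map_simplex2 f c \<in> simplices2 B s"
      using c f order_map_simplices1[OF f]
      by (auto simp: simplices2_def simplex2.map_sel simplex1.map_sel)
        (auto simp: order_map_def simplices1_def)
    then show ?thesis
      unfolding elementary_deformation_def pq
      by (intro bexI[of _ "map_simplex2 f c"] exI[of _ "map (map_simplex1 f) u"]
          exI[of _ "map (map_simplex1 f) v"]) (auto simp: simplex2.map_sel)
  qed
  from assms(2) show ?thesis
    by (induction rule: equivclp_induct)
      (auto intro: equivclp_trans r_into_equivclp converse_r_into_equivclp dest: *)
qed

lemma pi1_map_class: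
  assumes "order_map A r B s f" "p \<in> paths A r a a"
  shows "pi1_map B s f a (homotopy A r a a `` {p}) =
    homotopy B s (f a) (f a) `` {map (map_simplex1 f) p}"
  unfolding pi1_map_eq_class_map
  by (intro class_map_class order_map_homotopic[OF assms(1)] order_map_paths[OF assms(1)] assms(2))

lemma pi1_map_group_hom:
  assumes "order_map A r B s f" "partial_order_on A r" "partial_order_on B s" "a \<in> A"
  shows "group_hom (pi1 A r a) (pi1 B s (f a)) (pi1_map B s f a)"
proof -
  have "pi1_map B s f a \<in> hom (pi1 A r a) (pi1 B s (f a))"
    unfolding pi1_map_eq_class_map
    by (intro class_map_hom order_map_homotopic[OF assms(1)] order_map_paths[OF assms(1)]) auto
  moreover have "f a \<in> B" using assms(1,4) by (auto simp: order_map_def)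
  ultimately show ?thesis
    using group_pi1[OF assms(2,4)] group_pi1[OF assms(3)]
    by (simp add: group_hom_def group_hom_axioms_def)
qed

section \<open>Invariance under poset isomorphism and change of base point\<close>

lemma pi1_poset_iso:
  assumes f: "poset_iso_on A r B s f" and A: "a \<in> A"
  shows "pi1 A r a \<cong> pi1 B s (f a)"
proof -
  define g where "g = inv_into A f"
  have bij: "bij_betw f A B"
    and ord: "\<And>x y. x \<in> A \<Longrightarrow> y \<in> A \<Longrightarrow> (x, y) \<in> r \<longleftrightarrow> (f x, f y) \<in> s"
    using f by (auto simp: poset_iso_on_def)
  have gf: "g (f x) = x" if "x \<in> A" for x
    using bij_betw_inv_into_left[OF bij that] by (simp add: g_def)
  have fg: "f (g y) = y" if "y \<in> B" for y
    using bij_betw_inv_into_right[OF bij that] by (simp add: g_def)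
  have gA: "g y \<in> A" if "y \<in> B" for y
    using bij_betw_apply[OF bij_betw_inv_into[OF bij] that] by (simp add: g_def)
  have f': "order_map A r B s f" using ord bij by (auto simp: order_map_def bij_betw_def)
  have g': "order_map B s A r g" using ord gA fg by (auto simp: order_map_def)
  \<comment> \<open>The round trips of \<open>f\<close> and \<open>g\<close> are known to be the
    identity on the carriers only. This suffices, as all vertices and supports occurring in a path
    lie in the carrier.\<close>
  have id_on: "map (map_simplex1 h) p = p"
    if "p \<in> paths C t c c" "\<And>x. x \<in> C \<Longrightarrow> h x = x" for h :: "'c \<Rightarrow> 'c" and p C t c
  proof (rule map_idI)
    fix b assume "b \<in> set p"
    then have "b \<in> simplices1 C t" using that(1) by (auto simp: paths_def)
    then show "map_simplex1 h b = b"
      using that(2) by (intro simplex1.expand) (auto simp: simplex1.map_sel simplices1_def)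
  qed
  have path': "map (map_simplex1 g) p \<in> paths A r a a" if "p \<in> paths B s (f a) (f a)" for p
    using order_map_paths[OF g' that] gf A by simp
  have "class_map B s (f a) (map (map_simplex1 f)) \<in> iso (pi1 A r a) (pi1 B s (f a))"
  proof (rule class_map_iso[where k = "map (map_simplex1 g)"])
    show "homotopic A r (map (map_simplex1 g) (map (map_simplex1 f) p)) p"
      if "p \<in> paths A r a a" for p
      using id_on[OF that, of "g \<circ> f"] gf by (simp add: simplex1.map_comp comp_def)
    show "homotopic B s (map (map_simplex1 f) (map (map_simplex1 g) p)) p"
      if "p \<in> paths B s (f a) (f a)" for p
      using id_on[OF that, of "f \<circ> g"] fg by (simp add: simplex1.map_comp comp_def)
  qed (use path' in \<open>auto intro: order_map_homotopic[OF f'] order_map_homotopic[OF g']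
      order_map_paths[OF f']\<close>)
  then show ?thesis by (auto simp: is_iso_def)
qed

text \<open>Conjugation by \<open>g\<close> and by its inverse path \<open>g'\<close>.
  Multiplicativity and both round trips come from cancelling the loops \<open>g' @ g\<close> and
  \<open>g @ g'\<close>.\<close>

lemma pi1_change_base_point:
  assumes A: "partial_order_on A r" and g: "g \<in> paths A r a b"
  shows "pi1 A r a \<cong> pi1 A r b"
proof -
  obtain g' where g': "g' \<in> paths A r b a"
    and inv: "homotopic A r (g' @ g) [const_simplex a]" "homotopic A r (g @ g') [const_simplex b]"
    using homotopic_inverse[OF A g] .
  have cancel: "homotopic A r (u @ u' @ p) p"
    if "p \<in> paths A r d c" "homotopic A r (u @ u') [const_simplex c]" for p u u' c d
    using equivclp_trans[OF homotopic_append[OF that(2) equivclp_refl, of p]]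
      homotopic_unit_left[OF A that(1)] by simp
  have cancel': "homotopic A r (p @ u @ u') p"
    if "p \<in> paths A r c d" "homotopic A r (u @ u') [const_simplex c]" for p u u' c d
    using equivclp_trans[OF homotopic_append[OF equivclp_refl that(2), of p]]
      homotopic_unit_right[OF A that(1)] by simp
  have "class_map A r b (\<lambda>p. g @ p @ g') \<in> iso (pi1 A r a) (pi1 A r b)"
  proof (rule class_map_iso[where k = "\<lambda>p. g' @ p @ g"])
    show "homotopic A r (g @ (p @ q) @ g') ((g @ p @ g') @ g @ q @ g')"
      if pq: "p \<in> paths A r a a" "q \<in> paths A r a a" for p q
    proof -
      have "homotopic A r (q @ g') (g' @ g @ q @ g')"
        using cancel[OF paths_append[OF pq(2) g'] inv(1)] by (rule equivclp_sym)
      from homotopic_append[OF equivclp_refl this, of "g @ p"] show ?thesis by simp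
    qed
    show "homotopic A r (g' @ (g @ p @ g') @ g) p" if p: "p \<in> paths A r a a" for p
      using equivclp_trans[OF cancel[OF paths_append[OF p paths_append[OF g' g]] inv(1)]
          cancel'[OF p inv(1)]] by simp
    show "homotopic A r (g @ (g' @ p @ g) @ g') p" if p: "p \<in> paths A r b b" for p
      using equivclp_trans[OF cancel[OF paths_append[OF p paths_append[OF g g']] inv(2)]
          cancel'[OF p inv(2)]] by simp
  qed (auto intro!: homotopic_append paths_append intro: g g')
  then show ?thesis by (auto simp: is_iso_def)
qed


section \<open>Path lifting in net bundles\<close>

context poset_net_bundle
begin

abbreviation Xle :: "'x rel" where
  "Xle \<equiv> canonical_order leK X eta J leX"

text \<open>Parallel transport: up to the fibre over the support, then down to the fibre over
  \<open>bd0 b\<close>. The inverse is taken relative to that fibre, since only between fibres is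
  \<open>J\<close> bijective.\<close>

definition transport :: "'k simplex1 \<Rightarrow> 'x \<Rightarrow> 'x" where
  "transport b y = inv_into (fibre X eta (bd0 b)) (J (supp1 b) (bd0 b)) (J (supp1 b) (bd1 b) y)"

text \<open>The horizontal simplex over \<open>b\<close> starting at \<open>y\<close>. For
  \<open>y\<close> in the fibre over \<open>bd1 b\<close>, its support is the common image of both
  vertices over \<open>supp1 b\<close>, hence above them.\<close>

definition lift_simplex :: "'k simplex1 \<Rightarrow> 'x \<Rightarrow> 'x simplex1" where
  "lift_simplex b y = Simplex1 (J (supp1 b) (bd1 b) y) (transport b y) y"

text \<open>Paths are traversed from the end of the list, so \<open>foldr transport p y\<close> is
  where the lift of \<open>p\<close> ends, and the head is lifted from the endpoint of the lifted
  tail.\<close>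

primrec lift_path :: "'k simplex1 list \<Rightarrow> 'x \<Rightarrow> 'x simplex1 list" where
  "lift_path [] y = []"
| "lift_path (b # p) y = lift_simplex b (foldr transport p y) # lift_path p y"

lemma lift_path_append: "lift_path (p @ q) y = lift_path p (foldr transport q y) @ lift_path q y"
  by (induction p) auto

lemma lift_path_eq_Nil [simp]: "lift_path p y = [] \<longleftrightarrow> p = []"
  by (cases p) auto

section \<open>Order and injectivity properties of \<open>J\<close> and of the canonical
  ordering\<close>

lemma base_refl: "a \<in> K \<Longrightarrow> (a, a) \<in> leK"
  using partial_order_onD_refl[OF poset_base] .

lemma base_trans: "(a, b) \<in> leK \<Longrightarrow> (b, c) \<in> leK \<Longrightarrow> (a, c) \<in> leK"
  using partial_order_onD(2)[OF poset_base] by (auto dest: transD)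

lemma fibre_refl: "a \<in> K \<Longrightarrow> y \<in> fibre X eta a \<Longrightarrow> (y, y) \<in> leX a"
  using partial_order_onD_refl[OF poset_fibre] .

lemma J_in_fibre: "(a, b) \<in> leK \<Longrightarrow> y \<in> fibre X eta a \<Longrightarrow> J b a y \<in> fibre X eta b"
  using J_bij by (auto simp: bij_betw_def)

lemma J_inject:
  "(a, b) \<in> leK \<Longrightarrow> y \<in> fibre X eta a \<Longrightarrow> z \<in> fibre X eta a \<Longrightarrow> J b a y = J b a z \<longleftrightarrow> y = z"
  using J_bij by (auto simp: bij_betw_def dest: inj_onD)

lemma J_mono_iff:
  "(a, b) \<in> leK \<Longrightarrow> y \<in> fibre X eta a \<Longrightarrow> z \<in> fibre X eta a \<Longrightarrow>
    (J b a y, J b a z) \<in> leX b \<longleftrightarrow> (y, z) \<in> leX a"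
  using J_iso by (auto simp: poset_iso_on_def)

lemma order_fibreI:
  assumes "(a, b) \<in> leK" "y \<in> fibre X eta a" "z \<in> fibre X eta b" "(J b a y, z) \<in> leX b"
  shows "(y, z) \<in> Xle"
  using assms by (auto simp: canonical_order_def fibre_def)

text \<open>Over a single base point \<open>J a a\<close> is the identity, so the canonical ordering
  restricts to the order of the fibre; this makes the inclusion of a fibre order preserving.\<close>

lemma order_fibre_iff:
  assumes "a \<in> K" "y \<in> fibre X eta a" "z \<in> fibre X eta a"
  shows "(y, z) \<in> Xle \<longleftrightarrow> (y, z) \<in> leX a"
  using assms J_refl base_refl by (auto simp: canonical_order_def fibre_def)

lemma order_map_eta: "order_map X Xle K leK eta"
  using proj_surj by (auto simp: order_map_def canonical_order_def)

lemma order_map_inclusion: "a \<in> K \<Longrightarrow> order_map (fibre X eta a) (leX a) X Xle (\<lambda>y. y)"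
  using order_fibre_iff by (auto simp: order_map_def fibre_def)

lemma fibre_paths:
  assumes "a \<in> K" "p \<in> paths (fibre X eta a) (leX a) y z"
  shows "p \<in> paths X Xle y z"
  using order_map_paths[OF order_map_inclusion[OF assms(1)] assms(2)]
  by (simp add: map_simplex1_ident)

lemma fibre_simplices1: "a \<in> K \<Longrightarrow> t \<in> simplices1 (fibre X eta a) (leX a) \<Longrightarrow> t \<in> simplices1 X Xle"
  using order_map_simplices1[OF order_map_inclusion] by (simp add: map_simplex1_ident)

section \<open>Transport along a single 1-simplex of the base\<close>

context
  fixes b assumes b: "b \<in> simplices1 K leK"
begin

lemma simplex_bounds: "(bd0 b, supp1 b) \<in> leK" "(bd1 b, supp1 b) \<in> leK" "bd0 b \<in> K" "bd1 b \<in> K" "supp1 b \<in> K"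
  using b by (auto simp: simplices1_def)

lemma inv_J_bd0:
  assumes "z \<in> fibre X eta (supp1 b)"
  shows "inv_into (fibre X eta (bd0 b)) (J (supp1 b) (bd0 b)) z \<in> fibre X eta (bd0 b)"
    and "J (supp1 b) (bd0 b) (inv_into (fibre X eta (bd0 b)) (J (supp1 b) (bd0 b)) z) = z"
  using bij_betw_inv_into_right[OF J_bij[OF simplex_bounds(1)] assms]
    bij_betw_apply[OF bij_betw_inv_into[OF J_bij[OF simplex_bounds(1)]] assms] by auto

lemma transport_in_fibre: "y \<in> fibre X eta (bd1 b) \<Longrightarrow> transport b y \<in> fibre X eta (bd0 b)"
  unfolding transport_def by (intro inv_J_bd0 J_in_fibre simplex_bounds)

lemma J_transport:
  "y \<in> fibre X eta (bd1 b) \<Longrightarrow> J (supp1 b) (bd0 b) (transport b y) = J (supp1 b) (bd1 b) y"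
  unfolding transport_def by (intro inv_J_bd0 J_in_fibre simplex_bounds)

text \<open>A point and its transport agree over everything above the support. This allows the
  transports along the three faces of a 2-simplex to be compared over its support.\<close>

lemma J_transport':
  assumes y: "y \<in> fibre X eta (bd1 b)" and k: "(supp1 b, k) \<in> leK"
  shows "J k (bd0 b) (transport b y) = J k (bd1 b) y"
  using J_transport[OF y] J_comp[OF simplex_bounds(1) k transport_in_fibre[OF y]]
    J_comp[OF simplex_bounds(2) k y] by simp

lemma lift_simplex_in:
  assumes y: "y \<in> fibre X eta (bd1 b)"
  shows "lift_simplex b y \<in> simplices1 X Xle"
proof -
  have J: "J (supp1 b) (bd1 b) y \<in> fibre X eta (supp1 b)"
    using J_in_fibre[OF simplex_bounds(2) y] .
  note T = transport_in_fibre[OF y]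
  have "(y, J (supp1 b) (bd1 b) y) \<in> Xle" "(transport b y, J (supp1 b) (bd1 b) y) \<in> Xle"
    using order_fibreI[OF simplex_bounds(2) y J] order_fibreI[OF simplex_bounds(1) T J]
      fibre_refl[OF simplex_bounds(5) J] by (simp_all add: J_transport[OF y])
  then show ?thesis
    using y J T by (auto simp: simplices1_def lift_simplex_def fibre_def)
qed

text \<open>The upward map preserves the order and the other one reflects it. Hence fibre paths can
  be carried along \<open>b\<close>.\<close>

lemma order_map_transport:
  "order_map (fibre X eta (bd1 b)) (leX (bd1 b)) (fibre X eta (bd0 b)) (leX (bd0 b)) (transport b)"
  unfolding order_map_def
proof (intro conjI ballI impI)
  show "transport b ` fibre X eta (bd1 b) \<subseteq> fibre X eta (bd0 b)"
    using transport_in_fibre by blast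
  fix y z assume yz: "y \<in> fibre X eta (bd1 b)" "z \<in> fibre X eta (bd1 b)" "(y, z) \<in> leX (bd1 b)"
  then show "(transport b y, transport b z) \<in> leX (bd0 b)"
    using J_mono_iff[OF simplex_bounds(1) transport_in_fibre transport_in_fibre, of y z]
      J_mono_iff[OF simplex_bounds(2), of y z] by (simp add: J_transport)
qed

text \<open>Both sides are deformations of the diagonal of a square of fibre and horizontal simplices.\<close>
lemma lift_simplex_slide1:
  assumes t: "t \<in> simplices1 (fibre X eta (bd1 b)) (leX (bd1 b))"
  shows "homotopic X Xle [lift_simplex b (bd0 t), t]
    [map_simplex1 (transport b) t, lift_simplex b (bd1 t)]"
proof -
  let ?F = "fibre X eta (bd1 b)" and ?k = "supp1 b"
  \<comment> \<open>This point lies above all vertices and supports of the square, so it supports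
    the diagonal \<open>?m\<close> and both triangles.\<close>
  let ?w = "J ?k (bd1 b) (supp1 t)"
  let ?m = "Simplex1 ?w (transport b (bd0 t)) (bd1 t)"
  let ?Tt = "map_simplex1 (transport b) t"
  have tF: "supp1 t \<in> ?F" "bd0 t \<in> ?F" "bd1 t \<in> ?F"
    and le: "(bd0 t, supp1 t) \<in> leX (bd1 b)" "(bd1 t, supp1 t) \<in> leX (bd1 b)"
    using t by (auto simp: simplices1_def)
  have w: "?w \<in> fibre X eta ?k" using J_in_fibre[OF simplex_bounds(2) tF(1)] .
  have J: "J ?k (bd1 b) (bd0 t) \<in> fibre X eta ?k" "J ?k (bd1 b) (bd1 t) \<in> fibre X eta ?k"
    using J_in_fibre[OF simplex_bounds(2)] tF by auto
  have Jle: "(J ?k (bd1 b) (bd0 t), ?w) \<in> leX ?k" "(J ?k (bd1 b) (bd1 t), ?w) \<in> leX ?k"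
      "(?w, ?w) \<in> leX ?k"
    using J_mono_iff[OF simplex_bounds(2)] tF le fibre_refl simplex_bounds w by auto
  have up: "(supp1 t, ?w) \<in> Xle" "(bd1 t, ?w) \<in> Xle"
    using order_fibreI[OF simplex_bounds(2) _ w] tF Jle by auto
  have Tup: "(transport b (supp1 t), ?w) \<in> Xle" "(transport b (bd0 t), ?w) \<in> Xle"
    using order_fibreI[OF simplex_bounds(1) transport_in_fibre w] tF Jle by (auto simp: J_transport)
  have Jup: "(J ?k (bd1 b) (bd0 t), ?w) \<in> Xle" "(J ?k (bd1 b) (bd1 t), ?w) \<in> Xle"
    using order_fibre_iff[OF simplex_bounds(5)] J w Jle by auto
  have Tt: "?Tt \<in> simplices1 X Xle"
    using fibre_simplices1[OF simplex_bounds(3) order_map_simplices1[OF order_map_transport t]] .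
  have tX: "t \<in> simplices1 X Xle" using fibre_simplices1[OF simplex_bounds(4) t] .
  have X: "?w \<in> X" "bd1 t \<in> X" "transport b (bd0 t) \<in> X"
    using w tF transport_in_fibre by (auto simp: fibre_def)
  have m: "?m \<in> simplices1 X Xle"
    using up Tup X by (auto simp: simplices1_def)
  have wref: "(?w, ?w) \<in> Xle" using order_fibre_iff[OF simplex_bounds(5) w w] Jle by simp
  have c: "Simplex2 ?w (lift_simplex b (bd0 t)) ?m t \<in> simplices2 X Xle"
    using m tX lift_simplex_in[OF tF(2)] X wref Jup up
    by (auto simp: simplices2_def lift_simplex_def)
  have c': "Simplex2 ?w ?Tt ?m (lift_simplex b (bd1 t)) \<in> simplices2 X Xle"
    using m Tt lift_simplex_in[OF tF(3)] X wref Jup Tup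
    by (auto simp: simplices2_def lift_simplex_def simplex1.map_sel)
  show ?thesis
    using equivclp_trans[OF equivclp_sym[OF homotopic_simplex2[OF c]], of "[?Tt, lift_simplex b (bd1 t)]"]
      homotopic_simplex2[OF c'] by simp
qed

text \<open>The lift moves past the simplices of \<open>f\<close> one at a time, beginning at the
  end of \<open>f\<close> where it is attached. Each slide replaces its start \<open>bd0 t\<close>
  by \<open>bd1 t\<close> and leaves a transported simplex behind.\<close>

lemma lift_simplex_slide:
  assumes "f \<in> paths (fibre X eta (bd1 b)) (leX (bd1 b)) y z"
  shows "homotopic X Xle (lift_simplex b z # f)
    (map (map_simplex1 (transport b)) f @ [lift_simplex b y])"
proof -
  have "f \<noteq> []" using assms by (simp add: paths_def)
  then show ?thesis using assms
  proof (induction f arbitrary: z rule: list_nonempty_induct)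
    case (single t)
    then show ?case using lift_simplex_slide1[of t] by (auto simp: paths_single)
  next
    case (cons t f)
    then have t: "t \<in> simplices1 (fibre X eta (bd1 b)) (leX (bd1 b))" "bd0 t = z"
      and f: "f \<in> paths (fibre X eta (bd1 b)) (leX (bd1 b)) y (bd1 t)"
      by (auto simp: paths_Cons)
    have "homotopic X Xle ([lift_simplex b (bd0 t), t] @ f)
        ([map_simplex1 (transport b) t, lift_simplex b (bd1 t)] @ f)"
      using homotopic_append[OF lift_simplex_slide1[OF t(1)] equivclp_refl] .
    also have "homotopic X Xle \<dots>
        ([map_simplex1 (transport b) t] @ map (map_simplex1 (transport b)) f @ [lift_simplex b y])"
      using homotopic_append[OF equivclp_refl cons.IH[OF f], of "[map_simplex1 (transport b) t]"] by simp
    finally show ?case by (simp add: t)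
  qed
qed

end

section \<open>Lifts of paths and of homotopies\<close>

lemma map_eta_lift_simplex:
  assumes "b \<in> simplices1 K leK" "y \<in> fibre X eta (bd1 b)"
  shows "map_simplex1 eta (lift_simplex b y) = b"
  using assms(2) transport_in_fibre[OF assms] J_in_fibre[OF simplex_bounds(2)[OF assms(1)] assms(2)]
  by (intro simplex1.expand) (simp add: lift_simplex_def fibre_def simplex1.map_sel)

lemma lift_path:
  assumes "q \<in> paths K leK a c" "y \<in> fibre X eta a"
  shows "foldr transport q y \<in> fibre X eta c"
    and "lift_path q y \<in> paths X Xle y (foldr transport q y)"
    and "map (map_simplex1 eta) (lift_path q y) = q"
proof -
  have "q \<noteq> []" using assms by (simp add: paths_def)
  \<comment> \<open>The claims are proved together: the head can be lifted once the lifted tail is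
    known to end in the fibre where the head starts.\<close>
  then have "foldr transport q y \<in> fibre X eta c \<and>
    lift_path q y \<in> paths X Xle y (foldr transport q y) \<and>
    map (map_simplex1 eta) (lift_path q y) = q"
    using assms(1)
  proof (induction q arbitrary: c rule: list_nonempty_induct)
    case (single b)
    then have b: "b \<in> simplices1 K leK" "bd1 b = a" "bd0 b = c" by (auto simp: paths_single)
    with assms(2) show ?case
      using transport_in_fibre[OF b(1), of y] lift_simplex_in[OF b(1), of y]
        map_eta_lift_simplex[OF b(1), of y]
      by (auto simp: paths_single) (simp_all add: lift_simplex_def)
  next
    case (cons b q)
    then have b: "b \<in> simplices1 K leK" "bd0 b = c" and q: "q \<in> paths K leK a (bd1 b)"
      by (auto simp: paths_Cons)
    note IH = cons.IH[OF q]
    let ?z = "foldr transport q y"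
    have z: "?z \<in> fibre X eta (bd1 b)" using IH by simp
    show ?case
      using IH cons.hyps b transport_in_fibre[OF b(1) z] lift_simplex_in[OF b(1) z]
        map_eta_lift_simplex[OF b(1) z]
      by (auto simp: paths_Cons) (simp_all add: lift_simplex_def)
  qed
  then show "foldr transport q y \<in> fibre X eta c"
    "lift_path q y \<in> paths X Xle y (foldr transport q y)"
    "map (map_simplex1 eta) (lift_path q y) = q" by auto
qed

text \<open>By functoriality of \<open>J\<close>, the two transports have the same image over
  \<open>supp2 c\<close>, and \<open>J\<close> is injective there. The image of \<open>y\<close>
  over \<open>supp2 c\<close> then supports a 2-simplex whose faces are the three lifts.\<close>

lemma lift_simplex2:
  assumes c: "c \<in> simplices2 K leK" and y: "y \<in> fibre X eta (bd1 (face1 c))"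
  shows "transport (face0 c) (transport (face2 c) y) = transport (face1 c) y"
    and "homotopic X Xle [lift_simplex (face1 c) y]
      [lift_simplex (face0 c) (transport (face2 c) y), lift_simplex (face2 c) y]"
proof -
  let ?k = "supp2 c" and ?b0 = "face0 c" and ?b1 = "face1 c" and ?b2 = "face2 c"
  have s: "?b0 \<in> simplices1 K leK" "?b1 \<in> simplices1 K leK" "?b2 \<in> simplices1 K leK"
    and k: "(supp1 ?b0, ?k) \<in> leK" "(supp1 ?b1, ?k) \<in> leK" "(supp1 ?b2, ?k) \<in> leK" "?k \<in> K"
    and bd: "bd0 ?b1 = bd0 ?b0" "bd0 ?b2 = bd1 ?b0" "bd1 ?b2 = bd1 ?b1"
    using c by (auto simp: simplices2_def)
  let ?z = "transport ?b2 y"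
  have y2: "y \<in> fibre X eta (bd1 ?b2)" using y bd by simp
  have z: "?z \<in> fibre X eta (bd1 ?b0)" using transport_in_fibre[OF s(3) y2] bd by simp
  have "J ?k (bd0 ?b0) (transport ?b0 ?z) = J ?k (bd1 ?b0) ?z"
    using J_transport'[OF s(1) z k(1)] .
  moreover have Jz: "J ?k (bd1 ?b0) ?z = J ?k (bd1 ?b1) y"
    using J_transport'[OF s(3) y2 k(3)] bd by simp
  moreover have "J ?k (bd0 ?b0) (transport ?b1 y) = J ?k (bd1 ?b1) y"
    using J_transport'[OF s(2) y k(2)] bd by simp
  ultimately show T: "transport ?b0 ?z = transport ?b1 y"
    using J_inject[of "bd0 ?b0" ?k "transport ?b0 ?z" "transport ?b1 y"]
      transport_in_fibre[OF s(1) z] transport_in_fibre[OF s(2) y] bd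
      base_trans[OF simplex_bounds(1)[OF s(1)] k(1)] by simp
  let ?w = "J ?k (bd1 ?b1) y"
  have w: "?w \<in> fibre X eta ?k"
    using J_in_fibre[OF base_trans[OF simplex_bounds(2)[OF s(2)] k(2)] y] .
  \<comment> \<open>The support of a lift is below the image of its starting point over
    \<open>supp2 c\<close>. For all three lifts that image is \<open>?w\<close>; for
    \<open>face0 c\<close> this is \<open>Jz\<close>.\<close>
  have up: "(J (supp1 b) (bd1 b) v, J ?k (bd1 b) v) \<in> Xle"
    if b: "b \<in> simplices1 K leK" "(supp1 b, ?k) \<in> leK" and v: "v \<in> fibre X eta (bd1 b)" for b v
    using J_comp[OF simplex_bounds(2)[OF b(1)] b(2) v]
      J_in_fibre[OF base_trans[OF simplex_bounds(2)[OF b(1)] b(2)] v] fibre_refl[OF k(4)]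
    by (intro order_fibreI[OF b(2)] J_in_fibre[OF simplex_bounds(2)[OF b(1)] v]) auto
  have "Simplex2 ?w (lift_simplex ?b0 ?z) (lift_simplex ?b1 y) (lift_simplex ?b2 y) \<in> simplices2 X Xle"
    using lift_simplex_in[OF s(1) z] lift_simplex_in[OF s(2) y] lift_simplex_in[OF s(3) y2]
      up[OF s(1) k(1) z] up[OF s(2) k(2) y] up[OF s(3) k(3) y2] T w bd Jz
    by (auto simp: simplices2_def lift_simplex_def fibre_def)
  from homotopic_simplex2[OF this]
  show "homotopic X Xle [lift_simplex ?b1 y] [lift_simplex ?b0 ?z, lift_simplex ?b2 y]" by simp
qed

text \<open>The part \<open>v\<close> is lifted as before, the replaced piece lifts to a
  deformation, and \<open>u\<close> is lifted from an unchanged point because both transports around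
  \<open>c\<close> agree.\<close>

lemma lift_path_deformation:
  assumes pq: "elementary_deformation K leK p q"
    and p: "p \<in> paths K leK a e" and y: "y \<in> fibre X eta a"
  shows "foldr transport p y = foldr transport q y \<and> homotopic X Xle (lift_path p y) (lift_path q y)"
proof -
  obtain c u v where c: "c \<in> simplices2 K leK"
    and pq: "p = u @ [face1 c] @ v" "q = u @ [face0 c, face2 c] @ v"
    using pq unfolding elementary_deformation_def by blast
  let ?z = "foldr transport v y"
  \<comment> \<open>The replaced piece starts at \<open>y\<close> itself if \<open>v\<close> is
    empty; the case is separate because paths are nonempty lists.\<close>
  have "?z \<in> fibre X eta (bd1 (face1 c))"
  proof (cases "v = []")
    case True
    with p y show ?thesis by (cases u) (auto simp: pq paths_def)
  next
    case False
    then have "v \<in> paths K leK a (bd1 (face1 c))"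
      using p by (auto simp: pq paths_def successively_append_iff successively_Cons)
    then show ?thesis using y by (rule lift_path)
  qed
  note z = lift_simplex2[OF c this]
  show ?thesis
    using equivclp_deformation_context[OF z(2), of "lift_path u (transport (face1 c) ?z)" "lift_path v y"]
    by (simp add: pq lift_path_append z(1))
qed

lemma lift_path_homotopic:
  assumes "homotopic K leK p q" and p: "p \<in> paths K leK a e" and y: "y \<in> fibre X eta a"
  shows "foldr transport p y = foldr transport q y" "homotopic X Xle (lift_path p y) (lift_path q y)"
proof -
  have "foldr transport p y = foldr transport q y \<and> homotopic X Xle (lift_path p y) (lift_path q y)"
    using assms(1)
  proof (induction rule: equivclp_induct)
    case base
    then show ?case by simp
  next
    case (step q q')
    then have q: "q \<in> paths K leK a e"
      using p homotopic_paths[of K leK p q] by blast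
    have q': "q' \<in> paths K leK a e"
      using q step.hyps(2) elementary_deformation_paths[of K leK] by blast
    \<comment> \<open>An elementary deformation may run in either direction, so lifting is applied
      from both \<open>q\<close> and \<open>q'\<close>.\<close>
    have "foldr transport q y = foldr transport q' y \<and>
        homotopic X Xle (lift_path q y) (lift_path q' y)"
      using step.hyps(2) lift_path_deformation[OF _ q y] lift_path_deformation[OF _ q' y]
      by (metis equivclp_sym)
    with step.IH show ?case by (auto intro: equivclp_trans)
  qed
  then show "foldr transport p y = foldr transport q y"
    "homotopic X Xle (lift_path p y) (lift_path q y)" by auto
qed

section \<open>Splitting paths of the total space into horizontal and fibre parts\<close>

lemma simplex_decomposition:
  assumes s: "s \<in> simplices1 X Xle"
  obtains f where "f \<in> simplices1 (fibre X eta (eta (bd0 s))) (leX (eta (bd0 s)))"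
    "bd0 f = bd0 s" "bd1 f = transport (map_simplex1 eta s) (bd1 s)"
    "homotopic X Xle [s] [f, lift_simplex (map_simplex1 eta s) (bd1 s)]"
proof -
  define b where "b = map_simplex1 eta s"
  have b: "b \<in> simplices1 K leK"
    unfolding b_def using order_map_simplices1[OF order_map_eta s] .
  have sel: "supp1 b = eta (supp1 s)" "bd0 b = eta (bd0 s)" "bd1 b = eta (bd1 s)"
    by (simp_all add: b_def simplex1.map_sel)
  have sX: "supp1 s \<in> fibre X eta (supp1 b)" "bd0 s \<in> fibre X eta (bd0 b)" "bd1 s \<in> fibre X eta (bd1 b)"
    and le: "(J (supp1 b) (bd0 b) (bd0 s), supp1 s) \<in> leX (supp1 b)"
      "(J (supp1 b) (bd1 b) (bd1 s), supp1 s) \<in> leX (supp1 b)"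
    using s by (auto simp: simplices1_def sel fibre_def canonical_order_def)
  \<comment> \<open>The support of \<open>s\<close> pulled back to the fibre over
    \<open>bd0 b\<close>. As \<open>J\<close> reflects the order, it lies above both
    \<open>bd0 s\<close> and the endpoint of the horizontal lift, so it supports the correcting
    fibre simplex \<open>f\<close>.\<close>
  define w where "w = inv_into (fibre X eta (bd0 b)) (J (supp1 b) (bd0 b)) (supp1 s)"
  have w: "w \<in> fibre X eta (bd0 b)" "J (supp1 b) (bd0 b) w = supp1 s"
    unfolding w_def using inv_J_bd0[OF b sX(1)] by auto
  note T = transport_in_fibre[OF b sX(3)]
  define f where "f = Simplex1 w (bd0 s) (transport b (bd1 s))"
  have "(bd0 s, w) \<in> leX (bd0 b)" "(transport b (bd1 s), w) \<in> leX (bd0 b)"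
    using J_mono_iff[OF simplex_bounds(1)[OF b] sX(2) w(1)] J_mono_iff[OF simplex_bounds(1)[OF b] T w(1)]
      w(2) le J_transport[OF b sX(3)] by simp_all
  then have f: "f \<in> simplices1 (fibre X eta (bd0 b)) (leX (bd0 b))"
    using w sX T by (simp add: f_def simplices1_def)
  have "(w, supp1 s) \<in> Xle"
    using order_fibreI[OF simplex_bounds(1)[OF b] w(1) sX(1)] w(2)
      fibre_refl[OF simplex_bounds(5)[OF b] sX(1)] by simp
  moreover have "(J (supp1 b) (bd1 b) (bd1 s), supp1 s) \<in> Xle"
    using order_fibre_iff[OF simplex_bounds(5)[OF b] J_in_fibre[OF simplex_bounds(2)[OF b] sX(3)] sX(1)]
      le by simp
  moreover have "(supp1 s, supp1 s) \<in> Xle"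
    using order_fibre_iff[OF simplex_bounds(5)[OF b] sX(1,1)]
      fibre_refl[OF simplex_bounds(5)[OF b] sX(1)] by simp
  \<comment> \<open>The triangle supported on \<open>supp1 s\<close> that factors \<open>s\<close>
    into its horizontal lift followed by \<open>f\<close>.\<close>
  ultimately have "Simplex2 (supp1 s) f s (lift_simplex b (bd1 s)) \<in> simplices2 X Xle"
    using s fibre_simplices1[OF simplex_bounds(3)[OF b] f] lift_simplex_in[OF b sX(3)] sX(1)
    by (auto simp: simplices2_def f_def lift_simplex_def fibre_def)
  from homotopic_simplex2[OF this] have "homotopic X Xle [s] [f, lift_simplex b (bd1 s)]"
    by simp
  then show thesis
    using that[of f] f by (simp add: f_def b_def simplex1.map_sel)
qed

lemma path_decomposition:
  assumes "p \<in> paths X Xle x z"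
  obtains f where
    "f \<in> paths (fibre X eta (eta z)) (leX (eta z)) (foldr transport (map (map_simplex1 eta) p) x) z"
    "homotopic X Xle p (f @ lift_path (map (map_simplex1 eta) p) x)"
proof -
  have "p \<noteq> []" using assms by (simp add: paths_def)
  then have "\<exists>f\<in>paths (fibre X eta (eta z)) (leX (eta z)) (foldr transport (map (map_simplex1 eta) p) x) z.
    homotopic X Xle p (f @ lift_path (map (map_simplex1 eta) p) x)"
    using assms
  proof (induction p arbitrary: z rule: list_nonempty_induct)
    case (single s)
    then have s: "s \<in> simplices1 X Xle" "bd1 s = x" "bd0 s = z" by (auto simp: paths_single)
    obtain f where f: "f \<in> simplices1 (fibre X eta (eta z)) (leX (eta z))"
      "bd0 f = z" "bd1 f = transport (map_simplex1 eta s) x"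
      "homotopic X Xle [s] [f, lift_simplex (map_simplex1 eta s) x]"
      using simplex_decomposition[OF s(1)] s by metis
    then show ?case by (intro bexI[of _ "[f]"]) (auto simp: paths_single)
  next
    case (cons s p)
    then have s: "s \<in> simplices1 X Xle" "bd0 s = z" and p: "p \<in> paths X Xle x (bd1 s)"
      by (auto simp: paths_Cons)
    define b where "b = map_simplex1 eta s"
    define q where "q = map (map_simplex1 eta) p"
    let ?y = "foldr transport q x"
    have b: "b \<in> simplices1 K leK" "bd1 b = eta (bd1 s)" "bd0 b = eta z"
      using order_map_simplices1[OF order_map_eta s(1)] s by (auto simp: b_def simplex1.map_sel)
    obtain g where g: "g \<in> simplices1 (fibre X eta (eta z)) (leX (eta z))"
      "bd0 g = z" "bd1 g = transport b (bd1 s)"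
      "homotopic X Xle [s] [g, lift_simplex b (bd1 s)]"
      using simplex_decomposition[OF s(1)] s b_def by metis
    obtain f where f: "f \<in> paths (fibre X eta (bd1 b)) (leX (bd1 b)) ?y (bd1 s)"
      "homotopic X Xle p (f @ lift_path q x)"
      using cons.IH[OF p] by (auto simp: q_def b(2))
    \<comment> \<open>The horizontal part of \<open>s\<close> comes after the fibre part
      \<open>f\<close> of the earlier path. Sliding it to the front turns \<open>f\<close> into its
      transport, in the same fibre as \<open>g\<close>.\<close>
    define f' where "f' = map (map_simplex1 (transport b)) f"
    have f': "f' \<in> paths (fibre X eta (eta z)) (leX (eta z)) (transport b ?y) (transport b (bd1 s))"
      using order_map_paths[OF order_map_transport[OF b(1)] f(1)] by (simp add: f'_def b(3))
    have "homotopic X Xle ([s] @ p) ([g, lift_simplex b (bd1 s)] @ (f @ lift_path q x))"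
      using g(4) f(2) by (rule homotopic_append)
    also have "homotopic X Xle \<dots> ([g] @ (f' @ [lift_simplex b ?y]) @ lift_path q x)"
      using equivclp_deformation_context[OF lift_simplex_slide[OF b(1) f(1)], of "[g]" "lift_path q x"]
      by (simp add: f'_def)
    finally have "homotopic X Xle (s # p) ((g # f') @ lift_path (b # q) x)" by simp
    moreover have "g # f' \<in> paths (fibre X eta (eta z)) (leX (eta z)) (transport b ?y) z"
    proof -
      have "f' \<noteq> []" using f' by (simp add: paths_def)
      then show ?thesis using f' g by (simp add: paths_Cons)
    qed
    ultimately show ?case
      by (intro bexI[of _ "g # f'"]) (simp_all add: b_def q_def)
  qed
  with that show thesis by blast
qed

section \<open>Kernel and image of the map induced by the projection\<close>

lemma map_eta_fibre_path:
  assumes a: "a \<in> K" and "f \<in> paths (fibre X eta a) (leX a) y z"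
  shows "homotopic K leK (map (map_simplex1 eta) f) [const_simplex a]"
proof -
  have s: "map_simplex1 eta t = const_simplex a" if "t \<in> simplices1 (fibre X eta a) (leX a)" for t
    using that by (cases t) (auto simp: simplices1_def fibre_def)
  have "f \<noteq> []" using assms by (simp add: paths_def)
  then show ?thesis using assms(2)
  proof (induction f arbitrary: z rule: list_nonempty_induct)
    case (single t)
    then show ?case using s by (simp add: paths_single)
  next
    case (cons t f)
    then have t: "t \<in> simplices1 (fibre X eta a) (leX a)"
      and f: "f \<in> paths (fibre X eta a) (leX a) y (bd1 t)"
      by (auto simp: paths_Cons)
    have "homotopic K leK ([const_simplex a] @ map (map_simplex1 eta) f)
        ([const_simplex a] @ [const_simplex a])"
      using homotopic_append[OF equivclp_refl cons.IH[OF f]] .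
    also have "homotopic K leK \<dots> [const_simplex a]"
      using homotopic_unit_left[OF poset_base const_path[OF poset_base a]] by simp
    finally show ?case by (simp add: s[OF t])
  qed
qed

lemma lift_const:
  assumes "a \<in> K" "x \<in> fibre X eta a"
  shows "transport (const_simplex a) x = x" "lift_simplex (const_simplex a) x = const_simplex x"
proof -
  show *: "transport (const_simplex a) x = x"
    using assms J_refl bij_betw_inv_into_left[OF J_bij[OF base_refl]] by (simp add: transport_def)
  show "lift_simplex (const_simplex a) x = const_simplex x"
    using * assms J_refl by (simp add: lift_simplex_def)
qed

text \<open>The lift of a null homotopic closed path is homotopic to the lift of a constant, which
  is constant. So in the decomposition of \<open>p\<close> the fibre part starts at \<open>x\<close>
  and carries the whole class of \<open>p\<close>.\<close>

lemma closed_path_in_fibre: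
  assumes a: "a \<in> K" and x: "x \<in> fibre X eta a" and p: "p \<in> paths X Xle x x"
    and const: "homotopic K leK (map (map_simplex1 eta) p) [const_simplex a]"
  obtains f where "f \<in> paths (fibre X eta a) (leX a) x x" "homotopic X Xle p f"
proof -
  let ?q = "map (map_simplex1 eta) p"
  have ex: "eta x = a" "x \<in> X" using x by (auto simp: fibre_def)
  have q: "?q \<in> paths K leK a a" using order_map_paths[OF order_map_eta p] ex by simp
  obtain f where f: "f \<in> paths (fibre X eta a) (leX a) (foldr transport ?q x) x"
    "homotopic X Xle p (f @ lift_path ?q x)"
    using path_decomposition[OF p] ex by blast
  have T: "foldr transport ?q x = x"
    using lift_path_homotopic(1)[OF const q x] lift_const[OF a x] by simp
  have "homotopic X Xle (lift_path ?q x) [const_simplex x]"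
    using lift_path_homotopic(2)[OF const q x] lift_const[OF a x] by simp
  from homotopic_append[OF equivclp_refl this, of f]
  have "homotopic X Xle (f @ lift_path ?q x) (f @ [const_simplex x])" .
  also have "homotopic X Xle \<dots> f"
    using homotopic_unit_right[OF canonical_order_poset fibre_paths[OF a f(1)]] by (simp add: T)
  finally have "homotopic X Xle p f" using f(2) by (blast intro: equivclp_trans)
  with f(1) T that show thesis by simp
qed

lemma closed_path_onto:
  assumes a: "a \<in> K" and x: "x \<in> fibre X eta a" and q: "q \<in> paths K leK a a"
    and conn: "pathwise_connected (fibre X eta a) (leX a)"
  obtains p where "p \<in> paths X Xle x x" "homotopic K leK (map (map_simplex1 eta) p) q"
proof -
  note l = lift_path[OF q x]
  obtain f where f: "f \<in> paths (fibre X eta a) (leX a) (foldr transport q x) x"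
    using conn l(1) x by (auto simp: pathwise_connected_def)
  \<comment> \<open>The fibre path closing up the lift projects to constant simplices, so it does
    not change the class of the projection.\<close>
  have "homotopic K leK (map (map_simplex1 eta) f @ q) ([const_simplex a] @ q)"
    using homotopic_append[OF map_eta_fibre_path[OF a f] equivclp_refl] .
  also have "homotopic K leK \<dots> q"
    using homotopic_unit_left[OF poset_base q] by simp
  finally have "homotopic K leK (map (map_simplex1 eta) (f @ lift_path q x)) q"
    by (simp add: l(3))
  with that paths_append[OF fibre_paths[OF a f] l(2)] show thesis by blast
qed

lemma exact_at_total_space:
  assumes a: "a \<in> K" and x: "x \<in> fibre X eta a"
  shows "exact_at (pi1 (fibre X eta a) (leX a) x) (pi1_map X Xle (\<lambda>y. y) x)
    (pi1 X Xle x) (pi1_map K leK eta x) (pi1 K leK a)"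
proof -
  let ?F = "fibre X eta a" and ?j = "pi1_map X Xle (\<lambda>y. y) x" and ?e = "pi1_map K leK eta x"
  have ex: "eta x = a" "x \<in> X" using x by (auto simp: fibre_def)
  have e: "group_hom (pi1 X Xle x) (pi1 K leK a) ?e"
    using pi1_map_group_hom[OF order_map_eta canonical_order_poset poset_base ex(2)] ex by simp
  have j: "group_hom (pi1 ?F (leX a) x) (pi1 X Xle x) ?j"
    using pi1_map_group_hom[OF order_map_inclusion[OF a] poset_fibre[OF a] canonical_order_poset x] .
  \<comment> \<open>The inclusion is the identity on points, so a fibre path is the same list read
    in \<open>X\<close>.\<close>
  have j_class: "?j (homotopy ?F (leX a) x x `` {f}) = homotopy X Xle x x `` {f}"
    if "f \<in> paths ?F (leX a) x x" for f
    using pi1_map_class[OF order_map_inclusion[OF a] that] by (simp add: map_simplex1_ident)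
  have e_class: "?e (homotopy X Xle x x `` {p}) = homotopy K leK a a `` {map (map_simplex1 eta) p}"
    if "p \<in> paths X Xle x x" for p
    using pi1_map_class[OF order_map_eta that] ex by simp
  \<comment> \<open>Membership in the kernel becomes null homotopy of the projected path.\<close>
  have e_one: "?e (homotopy X Xle x x `` {p}) = \<one>\<^bsub>pi1 K leK a\<^esub> \<longleftrightarrow>
      homotopic K leK (map (map_simplex1 eta) p) [const_simplex a]" if "p \<in> paths X Xle x x" for p
    using homotopy_class_eq_iff order_map_paths[OF order_map_eta that] ex
    by (simp add: e_class[OF that] one_pi1)
  have "?j ` carrier (pi1 ?F (leX a) x) = kernel (pi1 X Xle x) (pi1 K leK a) ?e"
  proof
    show "?j ` carrier (pi1 ?F (leX a) x) \<subseteq> kernel (pi1 X Xle x) (pi1 K leK a) ?e"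
    proof (intro subsetI)
      fix P assume "P \<in> ?j ` carrier (pi1 ?F (leX a) x)"
      then obtain f where f: "f \<in> paths ?F (leX a) x x" "P = homotopy X Xle x x `` {f}"
        by (auto simp: carrier_pi1 j_class)
      have f': "f \<in> paths X Xle x x" using fibre_paths[OF a f(1)] .
      have "?e P = \<one>\<^bsub>pi1 K leK a\<^esub>"
        using e_one[OF f'] map_eta_fibre_path[OF a f(1)] by (simp add: f(2))
      then show "P \<in> kernel (pi1 X Xle x) (pi1 K leK a) ?e"
        using f' f(2) by (auto simp: kernel_def carrier_pi1)
    qed
    show "kernel (pi1 X Xle x) (pi1 K leK a) ?e \<subseteq> ?j ` carrier (pi1 ?F (leX a) x)"
    proof
      fix P assume "P \<in> kernel (pi1 X Xle x) (pi1 K leK a) ?e"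
      then obtain p where p: "p \<in> paths X Xle x x" "P = homotopy X Xle x x `` {p}"
        "homotopic K leK (map (map_simplex1 eta) p) [const_simplex a]"
        by (auto simp: kernel_def carrier_pi1 e_one)
      obtain f where f: "f \<in> paths ?F (leX a) x x" "homotopic X Xle p f"
        using closed_path_in_fibre[OF a x p(1,3)] .
      have "P = ?j (homotopy ?F (leX a) x x `` {f})"
        using homotopy_class_eq_iff[OF p(1)] f by (simp add: p(2) j_class)
      then show "P \<in> ?j ` carrier (pi1 ?F (leX a) x)"
        using f(1) by (auto simp: carrier_pi1)
    qed
  qed
  with e j show ?thesis by (simp add: exact_at_def)
qed

lemma pi1_map_eta_surj:
  assumes a: "a \<in> K" and x: "x \<in> fibre X eta a"
    and conn: "pathwise_connected (fibre X eta a) (leX a)"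
  shows "pi1_map K leK eta x ` carrier (pi1 X Xle x) = carrier (pi1 K leK a)"
proof -
  have ex: "eta x = a" using x by (auto simp: fibre_def)
  have e_class: "pi1_map K leK eta x (homotopy X Xle x x `` {p}) =
      homotopy K leK a a `` {map (map_simplex1 eta) p}"
    and e_path: "map (map_simplex1 eta) p \<in> paths K leK a a"
    if "p \<in> paths X Xle x x" for p
    using pi1_map_class[OF order_map_eta that] order_map_paths[OF order_map_eta that] ex by auto
  show ?thesis
  proof
    show "pi1_map K leK eta x ` carrier (pi1 X Xle x) \<subseteq> carrier (pi1 K leK a)"
      using e_path by (auto simp: carrier_pi1 e_class)
    show "carrier (pi1 K leK a) \<subseteq> pi1_map K leK eta x ` carrier (pi1 X Xle x)"
    proof
      fix Q assume "Q \<in> carrier (pi1 K leK a)"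
      then obtain q where q: "q \<in> paths K leK a a" "Q = homotopy K leK a a `` {q}"
        by (auto simp: carrier_pi1)
      obtain p where p: "p \<in> paths X Xle x x" "homotopic K leK (map (map_simplex1 eta) p) q"
        using closed_path_onto[OF a x q(1) conn] .
      then have "pi1_map K leK eta x (homotopy X Xle x x `` {p}) = Q"
        using homotopy_class_eq_iff[OF e_path[OF p(1)]] by (simp add: q(2) e_class)
      with p(1) show "Q \<in> pi1_map K leK eta x ` carrier (pi1 X Xle x)"
        by (auto simp: carrier_pi1)
    qed
  qed
qed

end

text \<open>The final term of the sequence is modelled by the one-element group. The kernel of the
  constant map is all of \<open>H\<close>, so exactness there amounts to surjectivity of
  \<open>f\<close>.\<close>

lemma exact_at_singleton:
  assumes "group_hom G H f" "f ` carrier G = carrier H"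
  shows "exact_at G f H (\<lambda>_. ()) (singleton_group ())"
proof -
  have "group H" using assms(1) by (simp add: group_hom_def)
  then have "group_hom H (singleton_group ()) (\<lambda>_. ())"
    using singleton_group[of "()"]
    by (auto simp: group_hom_def group_hom_axioms_def hom_def)
  with assms show ?thesis
    by (auto simp: exact_at_def kernel_def singleton_group_def)
qed

section \<open>The exact sequence and the case of a simply connected fibre\<close>

theorem theorem4p3:
  fixes K :: "'k set" and leK :: "'k rel"
    and X :: "'x set" and eta :: "'x \<Rightarrow> 'k" and J :: "'k \<Rightarrow> 'k \<Rightarrow> 'x \<Rightarrow> 'x"
    and leX :: "'k \<Rightarrow> 'x rel"
    and F :: "'f set" and leF :: "'f rel"
  assumes "poset_net_bundle K leK X eta J leX"
    and "pathwise_connected K leK"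
    and "standard_fibre F leF K X eta leX"
    and "pathwise_connected F leF"
  shows "\<forall>a\<in>K. \<forall>x\<in>fibre X eta a.
      (\<forall>a'\<in>F. pi1 (fibre X eta a) (leX a) x \<cong> pi1 F leF a') \<and>
      exact_at
        (pi1 (fibre X eta a) (leX a) x)
        (pi1_map X (canonical_order leK X eta J leX) (\<lambda>y. y) x)
        (pi1 X (canonical_order leK X eta J leX) x)
        (pi1_map K leK eta x)
        (pi1 K leK a) \<and>
      exact_at
        (pi1 X (canonical_order leK X eta J leX) x)
        (pi1_map K leK eta x)
        (pi1 K leK a)
        (\<lambda>_. ())
        (singleton_group ()) \<and>
      (simply_connected_poset F leF \<longrightarrow>
        pi1_map K leK eta x \<in> iso (pi1 X (canonical_order leK X eta J leX) x) (pi1 K leK a))"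
proof (intro ballI)
  interpret poset_net_bundle K leK X eta J leX by fact
  fix a x assume a: "a \<in> K" and x: "x \<in> fibre X eta a"
  let ?F = "fibre X eta a" and ?e = "pi1_map K leK eta x"
  obtain f where F: "partial_order_on F leF" and f: "poset_iso_on F leF ?F (leX a) f"
    using assms(3) a by (auto simp: standard_fibre_def)
  have f_map: "order_map F leF ?F (leX a) f" and f_onto: "f ` F = ?F"
    using f by (auto simp: poset_iso_on_def order_map_def bij_betw_def)
  \<comment> \<open>Connectedness passes from \<open>F\<close> to the actual fibre by mapping paths
    along \<open>f\<close>.\<close>
  have conn: "pathwise_connected ?F (leX a)"
    unfolding pathwise_connected_def
  proof (intro ballI)
    fix y z assume "y \<in> ?F" "z \<in> ?F"
    then obtain y' z' where "y' \<in> F" "z' \<in> F" "y = f y'" "z = f z'"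
      using f_onto by blast
    then show "paths ?F (leX a) y z \<noteq> {}"
      using assms(4) order_map_paths[OF f_map, of _ y' z'] by (force simp: pathwise_connected_def)
  qed
  \<comment> \<open>The isomorphism \<open>f\<close> matches \<open>x\<close> with some
    \<open>x'\<close> in \<open>F\<close>; a path in \<open>F\<close> then moves the base point from
    \<open>x'\<close> to \<open>a'\<close>.\<close>
  have fibre_iso: "pi1 ?F (leX a) x \<cong> pi1 F leF a'" if a': "a' \<in> F" for a'
  proof -
    obtain x' where x': "x' \<in> F" "x = f x'" using x f_onto by blast
    have "group (pi1 F leF x')" using group_pi1[OF F x'(1)] .
    then have "pi1 ?F (leX a) x \<cong> pi1 F leF x'"
      using pi1_poset_iso[OF f x'(1)] by (simp add: group.iso_sym x'(2))
    also obtain g where "g \<in> paths F leF x' a'"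
      using assms(4) a' x'(1) by (auto simp: pathwise_connected_def)
    then have "pi1 F leF x' \<cong> pi1 F leF a'" by (rule pi1_change_base_point[OF F])
    finally show ?thesis .
  qed
  note exact = exact_at_total_space[OF a x]
  have e: "group_hom (pi1 X Xle x) (pi1 K leK a) ?e" using exact by (simp add: exact_at_def)
  note surj = pi1_map_eta_surj[OF a x conn]
  have "?e \<in> iso (pi1 X Xle x) (pi1 K leK a)" if sc: "simply_connected_poset F leF"
  proof -
    \<comment> \<open>\<open>F\<close> is nonempty because \<open>x\<close> lies in a fibre
      isomorphic to it.\<close>
    obtain a' where a': "a' \<in> F" using x f_onto by blast
    have "trivial_group (pi1 F leF a')"
      using sc a' by (simp add: simply_connected_poset_def)
    then have "trivial_group (pi1 ?F (leX a) x)"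
      using isomorphic_group_triviality[OF fibre_iso[OF a']] group_pi1[OF poset_fibre[OF a] x]
      by (simp add: trivial_group_def)
    \<comment> \<open>By exactness this kernel is the image of a morphism from a trivial
      group.\<close>
    then have "kernel (pi1 X Xle x) (pi1 K leK a) ?e = {\<one>\<^bsub>pi1 X Xle x\<^esub>}"
      using exact unfolding exact_at_def by (metis group_hom.image_from_trivial_group)
    then have "inj_on ?e (carrier (pi1 X Xle x))"
      using group_hom.inj_iff_trivial_ker[OF e] by simp
    then show ?thesis
      using surj group_hom.homh[OF e] by (simp add: iso_def bij_betw_def)
  qed
  with fibre_iso exact exact_at_singleton[OF e surj]
  show "(\<forall>a'\<in>F. pi1 ?F (leX a) x \<cong> pi1 F leF a') \<and>
      exact_at (pi1 ?F (leX a) x) (pi1_map X Xle (\<lambda>y. y) x) (pi1 X Xle x) ?e (pi1 K leK a) \<and>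
      exact_at (pi1 X Xle x) ?e (pi1 K leK a) (\<lambda>_. ()) (singleton_group ()) \<and>
      (simply_connected_poset F leF \<longrightarrow> ?e \<in> iso (pi1 X Xle x) (pi1 K leK a))"
    by blast
qed

end
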